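(* Let $3\le Q\le 7$ be an integer, and let $\lambda>\lambda_*$, where $\lambda_*:=\frac{3-\sqrt5}{2}Q+\sqrt5=\|A_{\mathbb G^{Q,2}}\|$. Then $$R_{A_{\mathbb G^{Q,2}}}(\lambda)=R_{A_{\mathbb G^Q}}(\lambda)\Big[\mathbf 1_{\ell^2(\mathbb G^Q)}+P_{\ell^2(\mathbb Z)}\Big(\mathbf 1_{\ell^2(\mathbb Z)}-\tfrac1\lambda W\big(\tfrac1\lambda\big)\Big)^{-1}P_{\ell^2(\mathbb Z)}R_{A_{\mathbb G^Q}}(\lambda)\Big],$$ where $W(\xi)$ is the operator acting on $\ell^2(\mathbb Z)$ whose matrix elements are, for $x,y\in\mathbb Z\subset\mathbb G^Q$, $$W_{x,y}(\xi)=\bigg(\frac{1-\sqrt{1-4(Q-1)\xi^2}}{2(Q-1)\xi}\bigg)^{d(x,y)}\frac{2(Q-1)}{Q-2+Q\sqrt{1-4(Q-1)\xi^2}}.$$ In addition, $\mathbb G^{Q,2}$ is recurrent.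
   Context: For a graph $X$ (undirected, self-loops allowed) the adjacency operator $A_X$ acts on $\ell^2(VX)$ and its matrix entry $A_{xy}$ is the number of edges joining $x$ and $y$; a single self-loop at $x$ contributes $A_{xx}=1$. $\mathbb G^Q$ is the homogeneous Cayley tree of order $Q$ (the infinite tree in which every vertex has degree $Q$), with graph distance $d$. $\mathbb G^{Q,2}$ is the graph obtained from $\mathbb G^Q$ by adding one self-loop at each vertex of a fixed subtree isomorphic to $\mathbb Z$ (a bi-infinite path); this subtree is denoted simply by $\mathbb Z\subset\mathbb G^Q$, and $P_{\ell^2(\mathbb Z)}$ is the orthogonal projection of $\ell^2(\mathbb G^Q)$ onto $\ell^2(\mathbb Z)$. $R_B(\lambda)=(\lambda\mathbf 1-B)^{-1}$ is the resolvent. A connected graph with bounded selfadjoint adjacency $A$ is called recurrent if $\lim_{\lambda\downarrow\|A\|}\langle R_A(\lambda)\delta_x,\delta_x\rangle=+\infty$ for a vertex $x$ (the property does not depend on $x$), and transient otherwise. *)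

theory Defs
  imports "HOL-Analysis.Analysis"
begin

section \<open>The complex Hilbert space of square-summable functions\<close>

definition square_summable :: "('a \<Rightarrow> complex) \<Rightarrow> bool" where
  "square_summable f \<longleftrightarrow> (\<lambda>x. (cmod (f x))\<^sup>2) summable_on UNIV"

lemma square_summable_0: "square_summable (\<lambda>_. 0)"
  by (simp add: square_summable_def)

typedef 'a ell2 = "{f :: 'a \<Rightarrow> complex. square_summable f}"
  morphisms coord Abs_ell2
  using square_summable_0 by blast

setup_lifting type_definition_ell2

lemma coord_summable: "(\<lambda>x. (cmod (coord f x))\<^sup>2) summable_on UNIV"
  using coord[of f] by (simp add: square_summable_def)

lemma ell2_eqI: "(\<And>x. coord f x = coord g x) \<Longrightarrow> f = g"
  by (metis coord_inject ext)

lemma square_summable_add: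
  assumes "square_summable f" "square_summable g"
  shows "square_summable (\<lambda>x. f x + g x)"
  unfolding square_summable_def
proof (rule summable_on_comparison_test)
  show "(\<lambda>x. 2 * (cmod (f x))\<^sup>2 + 2 * (cmod (g x))\<^sup>2) summable_on UNIV"
    using assms unfolding square_summable_def
    by (intro summable_on_add summable_on_cmult_right)
next
  fix x
  have "(cmod (f x + g x))\<^sup>2 \<le> (cmod (f x) + cmod (g x))\<^sup>2"
    by (intro power_mono norm_triangle_ineq) auto
  also have "\<dots> \<le> 2 * (cmod (f x))\<^sup>2 + 2 * (cmod (g x))\<^sup>2"
    using zero_le_power2[of "cmod (f x) - cmod (g x)"]
    by (simp add: power2_sum power2_diff)
  finally show "(cmod (f x + g x))\<^sup>2 \<le> 2 * (cmod (f x))\<^sup>2 + 2 * (cmod (g x))\<^sup>2" .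
qed auto

lemma square_summable_scale:
  assumes "square_summable f"
  shows "square_summable (\<lambda>x. c * f x)"
  using summable_on_cmult_right[OF assms[unfolded square_summable_def], of "(cmod c)\<^sup>2"]
  by (simp add: square_summable_def norm_mult power_mult_distrib)

lemma square_summable_minus: "square_summable f \<Longrightarrow> square_summable (\<lambda>x. - f x)"
  by (simp add: square_summable_def)

lemma square_summable_diff:
  "square_summable f \<Longrightarrow> square_summable g \<Longrightarrow> square_summable (\<lambda>x. f x - g x)"
  using square_summable_add[of f "\<lambda>x. - g x"] square_summable_minus[of g] by simp

lemma coord_mult_summable: "(\<lambda>x. coord f x * cnj (coord g x)) summable_on UNIV"
proof (rule abs_summable_summable, rule summable_on_comparison_test)
  show "(\<lambda>x. (cmod (coord f x))\<^sup>2 + (cmod (coord g x))\<^sup>2) summable_on UNIV"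
    by (intro summable_on_add coord_summable)
next
  fix x
  have "0 \<le> (cmod (coord f x) - cmod (coord g x))\<^sup>2" by simp
  hence "2 * (cmod (coord f x) * cmod (coord g x)) \<le> (cmod (coord f x))\<^sup>2 + (cmod (coord g x))\<^sup>2"
    by (simp add: power2_diff)
  moreover have "0 \<le> cmod (coord f x) * cmod (coord g x)" by simp
  ultimately show "norm (coord f x * cnj (coord g x))
      \<le> (cmod (coord f x))\<^sup>2 + (cmod (coord g x))\<^sup>2"
    unfolding norm_mult complex_mod_cnj by linarith
qed simp

definition cinner :: "'a ell2 \<Rightarrow> 'a ell2 \<Rightarrow> complex" where
  "cinner f g = (\<Sum>\<^sub>\<infinity>x. coord f x * cnj (coord g x))"

instantiation ell2 :: (type) real_vector
begin

lift_definition zero_ell2 :: "'a ell2" is "\<lambda>_. 0"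
  by (rule square_summable_0)
lift_definition plus_ell2 :: "'a ell2 \<Rightarrow> 'a ell2 \<Rightarrow> 'a ell2" is "\<lambda>f g x. f x + g x"
  by (rule square_summable_add)
lift_definition minus_ell2 :: "'a ell2 \<Rightarrow> 'a ell2 \<Rightarrow> 'a ell2" is "\<lambda>f g x. f x - g x"
  by (rule square_summable_diff)
lift_definition uminus_ell2 :: "'a ell2 \<Rightarrow> 'a ell2" is "\<lambda>f x. - f x"
  by (rule square_summable_minus)
lift_definition scaleR_ell2 :: "real \<Rightarrow> 'a ell2 \<Rightarrow> 'a ell2" is "\<lambda>r f x. complex_of_real r * f x"
  by (rule square_summable_scale)

instance
  by standard (transfer; auto simp: algebra_simps)+

end

lemmas coord_simps [simp] =
  zero_ell2.rep_eq plus_ell2.rep_eq minus_ell2.rep_eq uminus_ell2.rep_eq scaleR_ell2.rep_eq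

lemma cinner_add_left: "cinner (f + g) h = cinner f h + cinner g h"
  by (simp add: cinner_def distrib_right infsum_add coord_mult_summable)

lemma cinner_scaleR_left: "cinner (r *\<^sub>R f) h = of_real r * cinner f h"
  by (simp add: cinner_def mult.assoc infsum_cmult_right')

lemma cinner_commute: "cinner f g = cnj (cinner g f)"
  by (simp add: cinner_def flip: infsum_cnj) (simp add: mult.commute)

lemma cinner_self: "cinner f f = of_real (\<Sum>\<^sub>\<infinity>x. (cmod (coord f x))\<^sup>2)"
proof -
  have "((\<lambda>x. complex_of_real ((cmod (coord f x))\<^sup>2)) has_sum
      of_real (\<Sum>\<^sub>\<infinity>x. (cmod (coord f x))\<^sup>2)) UNIV"
    by (intro has_sum_of_real has_sum_infsum coord_summable)
  thus ?thesis
    unfolding cinner_def complex_norm_square by (rule infsumI)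
qed

instantiation ell2 :: (type) real_inner
begin

definition inner_ell2 :: "'a ell2 \<Rightarrow> 'a ell2 \<Rightarrow> real" where
  "inner_ell2 f g = Re (cinner f g)"

definition norm_ell2 :: "'a ell2 \<Rightarrow> real" where
  "norm_ell2 f = sqrt (\<Sum>\<^sub>\<infinity>x. (cmod (coord f x))\<^sup>2)"

definition dist_ell2 :: "'a ell2 \<Rightarrow> 'a ell2 \<Rightarrow> real" where
  "dist_ell2 f g = norm (f - g)"

definition sgn_ell2 :: "'a ell2 \<Rightarrow> 'a ell2" where
  "sgn_ell2 f = inverse (norm f) *\<^sub>R f"

definition uniformity_ell2 :: "('a ell2 \<times> 'a ell2) filter" where
  "uniformity_ell2 = (INF e\<in>{0<..}. principal {(f, g). dist f g < e})"

definition open_ell2 :: "'a ell2 set \<Rightarrow> bool" where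
  "open_ell2 U \<longleftrightarrow> (\<forall>x\<in>U. eventually (\<lambda>(x', y). x' = x \<longrightarrow> y \<in> U) uniformity)"

instance
proof
  fix f g h :: "'a ell2" and r :: real
  show "f \<bullet> g = g \<bullet> f"
    unfolding inner_ell2_def by (subst cinner_commute) simp
  show "(f + g) \<bullet> h = f \<bullet> h + g \<bullet> h"
    by (simp add: inner_ell2_def cinner_add_left)
  show "(r *\<^sub>R f) \<bullet> g = r * (f \<bullet> g)"
    by (simp add: inner_ell2_def cinner_scaleR_left)
  show "0 \<le> f \<bullet> f"
    by (simp add: inner_ell2_def cinner_self infsum_nonneg)
  show "(f \<bullet> f = 0) = (f = 0)"
  proof
    assume "f \<bullet> f = 0"
    hence "(\<Sum>\<^sub>\<infinity>x. (cmod (coord f x))\<^sup>2) = 0"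
      by (simp add: inner_ell2_def cinner_self)
    hence "(cmod (coord f x))\<^sup>2 = 0" for x
      by (intro nonneg_infsum_le_0D[of "\<lambda>x. (cmod (coord f x))\<^sup>2" UNIV])
         (auto simp: coord_summable)
    thus "f = 0" by (intro ell2_eqI) simp
  qed (simp add: inner_ell2_def cinner_self)
  show "norm f = sqrt (f \<bullet> f)"
    by (simp add: norm_ell2_def inner_ell2_def cinner_self)
qed (simp_all add: dist_ell2_def sgn_ell2_def uniformity_ell2_def open_ell2_def)

end

lemma norm_coord_le: "cmod (coord f x) \<le> norm f"
proof -
  have "(\<Sum>y\<in>{x}. (cmod (coord f y))\<^sup>2) \<le> (\<Sum>\<^sub>\<infinity>y. (cmod (coord f y))\<^sup>2)"
    by (rule finite_sum_le_infsum) (auto simp: coord_summable)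
  thus ?thesis unfolding norm_ell2_def by (simp add: real_le_rsqrt)
qed

lemma sum_coord_le: "finite F \<Longrightarrow> (\<Sum>x\<in>F. (cmod (coord f x))\<^sup>2) \<le> (norm f)\<^sup>2"
  unfolding norm_ell2_def
  by (simp add: infsum_nonneg finite_sum_le_infsum coord_summable)

lemma square_summableI:
  assumes "\<And>F. finite F \<Longrightarrow> (\<Sum>x\<in>F. (cmod (f x))\<^sup>2) \<le> C"
  shows "square_summable f"
  unfolding square_summable_def
  by (rule nonneg_bdd_above_summable_on) (auto intro!: bdd_aboveI[of _ C] assms)

lemma norm_ell2_leI:
  assumes "\<And>F. finite F \<Longrightarrow> (\<Sum>x\<in>F. (cmod (coord f x))\<^sup>2) \<le> C\<^sup>2" "0 \<le> C"
  shows "norm f \<le> C"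
proof -
  have "(\<Sum>\<^sub>\<infinity>x. (cmod (coord f x))\<^sup>2) \<le> C\<^sup>2"
    by (rule infsum_le_finite_sums) (auto simp: coord_summable assms)
  thus ?thesis unfolding norm_ell2_def using assms(2) by (metis real_sqrt_le_mono real_sqrt_unique)
qed

instance ell2 :: (type) complete_space
proof
  fix X :: "nat \<Rightarrow> 'a ell2"
  assume C: "Cauchy X"
  have lim: "convergent (\<lambda>n. coord (X n) x)" for x
  proof (rule Cauchy_convergent, rule metric_CauchyI)
    fix e :: real assume "0 < e"
    then obtain M where M: "\<And>m n. m \<ge> M \<Longrightarrow> n \<ge> M \<Longrightarrow> dist (X m) (X n) < e"
      using metric_CauchyD[OF C] by blast
    have "dist (coord (X m) x) (coord (X n) x) < e" if "m \<ge> M" "n \<ge> M" for m n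
      using norm_coord_le[of "X m - X n" x] M[OF that] by (simp add: dist_norm)
    thus "\<exists>M. \<forall>m\<ge>M. \<forall>n\<ge>M. dist (coord (X m) x) (coord (X n) x) < e" by blast
  qed
  define L where "L x = lim (\<lambda>n. coord (X n) x)" for x
  have L: "(\<lambda>n. coord (X n) x) \<longlonglongrightarrow> L x" for x
    unfolding L_def using lim convergent_LIMSEQ_iff by blast
  have fin: "(\<Sum>x\<in>F. (cmod (coord (X n) x - L x))\<^sup>2) \<le> e\<^sup>2"
    if F: "finite F" and e: "\<And>m. m \<ge> M \<Longrightarrow> norm (X n - X m) \<le> e" "0 \<le> e" for F n M e
  proof (rule tendsto_upperbound)
    show "(\<lambda>m. \<Sum>x\<in>F. (cmod (coord (X n) x - coord (X m) x))\<^sup>2)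
        \<longlonglongrightarrow> (\<Sum>x\<in>F. (cmod (coord (X n) x - L x))\<^sup>2)"
      by (intro tendsto_intros L)
    have "(\<Sum>x\<in>F. (cmod (coord (X n) x - coord (X m) x))\<^sup>2) \<le> e\<^sup>2" if "m \<ge> M" for m
    proof -
      have "(\<Sum>x\<in>F. (cmod (coord (X n) x - coord (X m) x))\<^sup>2) \<le> (norm (X n - X m))\<^sup>2"
        using sum_coord_le[OF F, of "X n - X m"] by simp
      also have "\<dots> \<le> e\<^sup>2" using e(1)[OF that] by (intro power_mono) auto
      finally show ?thesis .
    qed
    thus "\<forall>\<^sub>F m in sequentially. (\<Sum>x\<in>F. (cmod (coord (X n) x - coord (X m) x))\<^sup>2) \<le> e\<^sup>2"
      using eventually_at_top_linorder by blast
  qed simp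
  obtain M where M: "\<And>m n. m \<ge> M \<Longrightarrow> n \<ge> M \<Longrightarrow> dist (X m) (X n) < 1"
    using metric_CauchyD[OF C, of 1] by auto
  have "square_summable (\<lambda>x. coord (X M) x - L x)"
    by (rule square_summableI[of _ "1\<^sup>2"], rule fin[of _ M])
       (auto simp: less_imp_le[OF M[unfolded dist_norm]])
  moreover have "square_summable (coord (X M))" using coord by blast
  ultimately have "square_summable (\<lambda>x. coord (X M) x - (coord (X M) x - L x))"
    by (rule square_summable_diff[rotated])
  hence sL: "square_summable L" by simp
  have cL: "coord (Abs_ell2 L) = L" by (simp add: Abs_ell2_inverse sL)
  have "X \<longlonglongrightarrow> Abs_ell2 L"
  proof (rule metric_LIMSEQ_I)
    fix r :: real assume r: "0 < r"
    then obtain N where N: "\<And>m n. m \<ge> N \<Longrightarrow> n \<ge> N \<Longrightarrow> dist (X m) (X n) < r / 2"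
      using metric_CauchyD[OF C, of "r / 2"] by auto
    have "dist (X n) (Abs_ell2 L) < r" if n: "n \<ge> N" for n
    proof -
      have "norm (X n - Abs_ell2 L) \<le> r / 2"
      proof (rule norm_ell2_leI)
        fix F :: "'a set" assume F: "finite F"
        have "norm (X n - X m) \<le> r / 2" if "m \<ge> N" for m
          using N[OF n that] by (simp add: dist_norm)
        thus "(\<Sum>x\<in>F. (cmod (coord (X n - Abs_ell2 L) x))\<^sup>2) \<le> (r / 2)\<^sup>2"
          using fin[OF F, of N n "r / 2"] r by (simp add: cL)
      qed (use r in simp)
      thus ?thesis using r by (simp add: dist_norm)
    qed
    thus "\<exists>no. \<forall>n\<ge>no. dist (X n) (Abs_ell2 L) < r" by blast
  qed
  thus "convergent X" by (rule convergentI)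
qed

instance ell2 :: (type) banach ..

lemma square_summable_delta: "square_summable (\<lambda>y. if y = x then 1 else 0)"
proof (rule square_summableI)
  fix F :: "'a set" assume "finite F"
  have "(\<Sum>y\<in>F. (cmod (if y = x then 1 else 0))\<^sup>2) = (\<Sum>y\<in>F. if y = x then 1 else 0)"
    by (intro sum.cong) auto
  also have "\<dots> \<le> (1::real)" using \<open>finite F\<close> by simp
  finally show "(\<Sum>y\<in>F. (cmod (if y = x then 1 else 0))\<^sup>2) \<le> 1" .
qed

lift_definition delta :: "'a \<Rightarrow> 'a ell2" is "\<lambda>x y. if y = x then 1 else 0"
  by (rule square_summable_delta)

text \<open>For \<open>S \<subseteq> 'a\<close> the Hilbert space \<open>\<ell>\<^sup>2(S)\<close> is identified, as usual, with the closed
  subspace of the functions in \<open>\<ell>\<^sup>2('a)\<close> that vanish off \<open>S\<close>.\<close>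

definition ell2_on :: "'a set \<Rightarrow> 'a ell2 set" where
  "ell2_on S = {f. \<forall>x. x \<notin> S \<longrightarrow> coord f x = 0}"

definition orthogonal_proj :: "'a ell2 set \<Rightarrow> 'a ell2 \<Rightarrow> 'a ell2" where
  "orthogonal_proj M f = (THE g. g \<in> M \<and> (\<forall>h\<in>M. cinner (f - g) h = 0))"

text \<open>The operator on \<open>\<ell>\<^sup>2(S)\<close> with matrix elements \<open>a x y\<close>, \<open>x, y \<in> S\<close>. It is meant for
  matrices whose action maps \<open>\<ell>\<^sup>2(S)\<close> to itself; outside that case \<open>Abs_ell2\<close> is
  unspecified.\<close>

definition matrix_op :: "'a set \<Rightarrow> ('a \<Rightarrow> 'a \<Rightarrow> complex) \<Rightarrow> 'a ell2 \<Rightarrow> 'a ell2" where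
  "matrix_op S a f = Abs_ell2 (\<lambda>x. if x \<in> S then \<Sum>\<^sub>\<infinity>y\<in>S. a x y * coord f y else 0)"

definition selfadjoint :: "('a ell2 \<Rightarrow> 'a ell2) \<Rightarrow> bool" where
  "selfadjoint B \<longleftrightarrow> (\<forall>f g. cinner (B f) g = cinner f (B g))"

definition boundedly_invertible_on :: "'a ell2 set \<Rightarrow> ('a ell2 \<Rightarrow> 'a ell2) \<Rightarrow> bool" where
  "boundedly_invertible_on M B \<longleftrightarrow>
     bij_betw B M M \<and> (\<exists>K. \<forall>f\<in>M. norm (inv_into M B f) \<le> K * norm f)"

definition resolvent :: "('a ell2 \<Rightarrow> 'a ell2) \<Rightarrow> real \<Rightarrow> 'a ell2 \<Rightarrow> 'a ell2" where
  "resolvent B l = inv (\<lambda>f. l *\<^sub>R f - B f)"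


section \<open>Graphs\<close>

text \<open>The vertices are the elements of the type \<open>'v\<close>; an edge is the set of its endpoints,
  so a self-loop at \<open>x\<close> is the edge \<open>{x}\<close>.\<close>

type_synonym 'v graph = "'v set set"

definition graph :: "'v graph \<Rightarrow> bool" where
  "graph X \<longleftrightarrow> (\<forall>e\<in>X. \<exists>x y. e = {x, y})"

definition adjacent :: "'v graph \<Rightarrow> 'v \<Rightarrow> 'v \<Rightarrow> bool" where
  "adjacent X x y \<longleftrightarrow> {x, y} \<in> X"

definition loopless :: "'v graph \<Rightarrow> bool" where
  "loopless X \<longleftrightarrow> (\<forall>x. {x} \<notin> X)"

definition connected_graph :: "'v graph \<Rightarrow> bool" where
  "connected_graph X \<longleftrightarrow> graph X \<and> (\<forall>x y. (adjacent X)\<^sup>*\<^sup>* x y)"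

definition graph_dist :: "'v graph \<Rightarrow> 'v \<Rightarrow> 'v \<Rightarrow> nat" where
  "graph_dist X x y = (LEAST n. (adjacent X ^^ n) x y)"

text \<open>Number of incident edges; a self-loop would be counted once, but it is only used for
  loopless graphs.\<close>

definition degree :: "'v graph \<Rightarrow> 'v \<Rightarrow> nat" where
  "degree X x = card {e \<in> X. x \<in> e}"

definition is_cycle :: "'v graph \<Rightarrow> 'v list \<Rightarrow> bool" where
  "is_cycle X p \<longleftrightarrow> 3 \<le> length p \<and> distinct p \<and>
     (\<forall>i<length p. adjacent X (p ! i) (p ! (Suc i mod length p)))"

definition tree :: "'v graph \<Rightarrow> bool" where
  "tree X \<longleftrightarrow> connected_graph X \<and> loopless X \<and> (\<nexists>p. is_cycle X p)"

definition homogeneous_tree :: "nat \<Rightarrow> 'v graph \<Rightarrow> bool" where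
  "homogeneous_tree Q X \<longleftrightarrow> tree X \<and> (\<forall>x. degree X x = Q)"

text \<open>The subgraph induced on \<open>Z\<close> is isomorphic to \<open>\<int>\<close>, two integers being joined iff they
  differ by one.\<close>

definition biinfinite_path :: "'v graph \<Rightarrow> 'v set \<Rightarrow> bool" where
  "biinfinite_path X Z \<longleftrightarrow>
     (\<exists>\<gamma> :: int \<Rightarrow> 'v. bij_betw \<gamma> UNIV Z \<and>
        (\<forall>m n. adjacent X (\<gamma> m) (\<gamma> n) \<longleftrightarrow> \<bar>m - n\<bar> = 1))"

definition add_loops :: "'v graph \<Rightarrow> 'v set \<Rightarrow> 'v graph" where
  "add_loops X Z = X \<union> (\<lambda>x. {x}) ` Z"

definition adjacency_op :: "'v graph \<Rightarrow> 'v ell2 \<Rightarrow> 'v ell2" where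
  "adjacency_op X = matrix_op UNIV (\<lambda>x y. of_nat (card {e \<in> X. e = {x, y}}))"

text \<open>For selfadjoint \<open>A\<close> and real \<open>l\<close> the number \<open>\<langle>R\<^sub>A(l) \<delta>\<^sub>x, \<delta>\<^sub>x\<rangle>\<close> is real, so taking
  \<open>Re\<close> only changes its type.\<close>

definition recurrent :: "'v graph \<Rightarrow> bool" where
  "recurrent X \<longleftrightarrow>
     connected_graph X \<and> bounded_linear (adjacency_op X) \<and> selfadjoint (adjacency_op X) \<and>
     (\<exists>x. filterlim (\<lambda>l. Re (cinner (resolvent (adjacency_op X) l (delta x)) (delta x)))
            at_top (at_right (onorm (adjacency_op X))))"


section \<open>The quantities of the resolvent formula\<close>

definition lambda_star :: "nat \<Rightarrow> real" where
  "lambda_star Q = (3 - sqrt 5) / 2 * real Q + sqrt 5"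

definition W_entry :: "nat \<Rightarrow> real \<Rightarrow> nat \<Rightarrow> real" where
  "W_entry Q \<xi> d =
     ((1 - sqrt (1 - 4 * (real Q - 1) * \<xi>\<^sup>2)) / (2 * (real Q - 1) * \<xi>)) ^ d *
     (2 * (real Q - 1) / (real Q - 2 + real Q * sqrt (1 - 4 * (real Q - 1) * \<xi>\<^sup>2)))"

definition W_op :: "nat \<Rightarrow> 'v graph \<Rightarrow> 'v set \<Rightarrow> real \<Rightarrow> 'v ell2 \<Rightarrow> 'v ell2" where
  "W_op Q X Z \<xi> = matrix_op Z (\<lambda>x y. of_real (W_entry Q \<xi> (graph_dist X x y)))"

end

theory Submission
  imports Defs
begin

text \<open>Let \<open>u\<^sub>* = (3 - \<surd>5)/2\<close>. The function \<open>\<phi>(x) = u\<^sub>* ^ d(x, \<int>)\<close> is a positive eigenfunction of the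
  adjacency operator \<open>A = A\<^sub>0 + P\<close> with eigenvalue \<open>\<lambda>\<^sub>*\<close>, so the Schur test bounds the norms of \<open>A\<close> and
  \<open>A\<^sub>0\<close> by \<open>\<lambda>\<^sub>*\<close>. For \<open>\<lambda> > \<lambda>\<^sub>*\<close> the resolvent applied to \<open>\<delta>\<^sub>x\<close> is dominated by a multiple of \<open>\<phi>\<close>, and
  there is only one dominated solution of \<open>\<lambda>h - Ah = \<delta>\<^sub>x\<close>; hence Green functions may be guessed, with no
  summability to check. This gives \<open>P R\<^sub>0 P = W(1/\<lambda>)/\<lambda>\<close> on \<open>\<ell>\<^sup>2(\<int>)\<close>, while \<open>1 - P R\<^sub>0 P\<close> is inverted by
  \<open>1 + P R P\<close>. The Green function of \<open>A\<close> at \<open>0 \<in> \<int>\<close> is a multiple of \<open>v ^ \<bar>\<pi>(x)\<bar> u ^ d(x, \<int>)\<close>, where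
  \<open>\<pi>\<close> is the nearest-point projection onto \<open>\<int>\<close>, \<open>\<lambda> = 1/u + (Q - 1) u\<close> and
  \<open>v + 1/v = 1/u + u - 1\<close>. Its value at \<open>0\<close> is \<open>1/(1/v - v)\<close>, which tends to infinity as
  \<open>\<lambda> \<down> \<lambda>\<^sub>*\<close> because \<open>u \<rightarrow> u\<^sub>*\<close> (here \<open>Q \<le> 7\<close> enters) and so \<open>v \<rightarrow> 1\<close>. This shows
  both recurrence and \<open>\<parallel>A\<parallel> \<ge> \<lambda>\<^sub>*\<close>.\<close>

section \<open>Square-summable functions and coordinate projections\<close>

lemma cinner_delta_right: "cinner f (delta x) = coord f x"
proof -
  have "cinner f (delta x) = (\<Sum>\<^sub>\<infinity>y\<in>{x}. coord f y * cnj (coord (delta x) y))"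
    unfolding cinner_def by (rule infsum_cong_neutral) (auto simp: delta.rep_eq)
  thus ?thesis by (simp add: delta.rep_eq)
qed

lemma norm_delta: "norm (delta x) = 1"
proof -
  have "(norm (delta x))\<^sup>2 = Re (cinner (delta x) (delta x))"
    by (simp add: power2_norm_eq_inner inner_ell2_def)
  hence "(norm (delta x))\<^sup>2 = 1" by (simp add: cinner_delta_right delta.rep_eq)
  thus ?thesis by (simp add: power2_eq_1_iff) (use norm_ge_zero[of "delta x"] in linarith)
qed

lemma norm_ell2_le_of_pointwise:
  assumes "\<And>x. cmod (coord f x) \<le> cmod (coord g x)"
  shows "norm f \<le> norm g"
proof (rule norm_ell2_leI)
  fix F :: "'a set" assume "finite F"
  have "(\<Sum>x\<in>F. (cmod (coord f x))\<^sup>2) \<le> (\<Sum>x\<in>F. (cmod (coord g x))\<^sup>2)"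
    by (intro sum_mono power_mono assms) auto
  also have "\<dots> \<le> (norm g)\<^sup>2" by (rule sum_coord_le[OF \<open>finite F\<close>])
  finally show "(\<Sum>x\<in>F. (cmod (coord f x))\<^sup>2) \<le> (norm g)\<^sup>2" .
qed simp

lift_definition restrict_ell2 :: "'a set \<Rightarrow> 'a ell2 \<Rightarrow> 'a ell2" is
  "\<lambda>S f x. if x \<in> S then f x else 0"
  unfolding square_summable_def
  by (rule summable_on_comparison_test) auto

lemma restrict_ell2_in: "restrict_ell2 S f \<in> ell2_on S"
  by (simp add: ell2_on_def restrict_ell2.rep_eq)

lemma restrict_ell2_id: "f \<in> ell2_on S \<Longrightarrow> restrict_ell2 S f = f"
  by (rule ell2_eqI) (auto simp: ell2_on_def restrict_ell2.rep_eq)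

lemma bounded_linear_restrict_ell2: "bounded_linear (restrict_ell2 S)"
proof (rule bounded_linear_intro[where K = 1])
  show "norm (restrict_ell2 S f) \<le> norm f * 1" for f :: "'a ell2"
    unfolding mult_1_right by (rule norm_ell2_le_of_pointwise) (simp add: restrict_ell2.rep_eq)
qed (rule ell2_eqI, simp add: restrict_ell2.rep_eq)+

lemma ell2_on_diff: "f \<in> ell2_on S \<Longrightarrow> g \<in> ell2_on S \<Longrightarrow> f - g \<in> ell2_on S"
  by (simp add: ell2_on_def)

lemma ell2_on_add: "f \<in> ell2_on S \<Longrightarrow> g \<in> ell2_on S \<Longrightarrow> f + g \<in> ell2_on S"
  by (simp add: ell2_on_def)

text \<open>Testing orthogonality against \<open>delta x\<close> for \<open>x\<close> in
  \<open>S\<close> forces the coordinates on \<open>S\<close>, so the definite description has only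
  the cut-off function as its value.\<close>

lemma orthogonal_proj_ell2_on: "orthogonal_proj (ell2_on S) = restrict_ell2 S"
proof (rule ext)
  fix f :: "'a ell2"
  show "orthogonal_proj (ell2_on S) f = restrict_ell2 S f"
    unfolding orthogonal_proj_def
  proof (rule the_equality)
    have "cinner (f - restrict_ell2 S f) h = 0" if "h \<in> ell2_on S" for h
    proof -
      have "(\<lambda>x. coord (f - restrict_ell2 S f) x * cnj (coord h x)) = (\<lambda>_. 0)"
        using that by (auto simp: ell2_on_def restrict_ell2.rep_eq)
      thus ?thesis by (simp only: cinner_def infsum_0_simp)
    qed
    thus "restrict_ell2 S f \<in> ell2_on S \<and> (\<forall>h\<in>ell2_on S. cinner (f - restrict_ell2 S f) h = 0)"
      by (simp add: restrict_ell2_in)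
  next
    fix g assume g: "g \<in> ell2_on S \<and> (\<forall>h\<in>ell2_on S. cinner (f - g) h = 0)"
    show "g = restrict_ell2 S f"
    proof (rule ell2_eqI)
      fix x
      show "coord g x = coord (restrict_ell2 S f) x"
      proof (cases "x \<in> S")
        case True
        hence "delta x \<in> ell2_on S" by (auto simp: ell2_on_def delta.rep_eq)
        hence "cinner (f - g) (delta x) = 0" using g by blast
        thus ?thesis using True by (simp add: cinner_delta_right restrict_ell2.rep_eq)
      qed (use g in \<open>simp add: ell2_on_def restrict_ell2.rep_eq\<close>)
    qed
  qed
qed


section \<open>Resolvents outside the norm disc\<close>

locale resolvent_point =
  fixes B :: "'a ell2 \<Rightarrow> 'a ell2" and l :: real
  assumes bounded_linear: "bounded_linear B" and onorm_less: "onorm B < l"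
begin

interpretation bounded_linear B by (rule bounded_linear)

lemma l_pos: "0 < l"
  using onorm_less onorm_pos_le[OF bounded_linear] by linarith

lemma norm_ge: "(l - onorm B) * norm g \<le> norm (l *\<^sub>R g - B g)"
proof -
  have "l * norm g = norm (l *\<^sub>R g)" using l_pos by simp
  also have "\<dots> \<le> norm (l *\<^sub>R g - B g) + norm (B g)"
    by (metis diff_add_cancel norm_triangle_ineq)
  also have "norm (B g) \<le> onorm B * norm g" by (rule onorm[OF bounded_linear])
  finally show ?thesis by (simp add: algebra_simps)
qed

text \<open>\<open>l *\<^sub>R g - B g = f\<close> is a fixed-point equation for a contraction with
  factor \<open>onorm B / l\<close>. The invariant closed set is left free: \<open>UNIV\<close>
  yields surjectivity, a set of dominated functions yields pointwise bounds on the
  resolvent.\<close>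

lemma solution_in_closed:
  assumes "closed S" "S \<noteq> {}" "\<And>g. g \<in> S \<Longrightarrow> (1 / l) *\<^sub>R (f + B g) \<in> S"
  obtains g where "g \<in> S" "l *\<^sub>R g - B g = f"
proof -
  have "\<exists>!g. g \<in> S \<and> (1 / l) *\<^sub>R (f + B g) = g"
  proof (rule Banach_fix)
    show "complete S" using assms(1) by (simp add: complete_eq_closed)
    show "0 \<le> onorm B / l" using onorm_pos_le[OF bounded_linear] l_pos by simp
    show "onorm B / l < 1" using onorm_less l_pos by simp
    show "(\<lambda>g. (1 / l) *\<^sub>R (f + B g)) ` S \<subseteq> S" using assms(3) by blast
    show "dist ((1 / l) *\<^sub>R (f + B g)) ((1 / l) *\<^sub>R (f + B h)) \<le> onorm B / l * dist g h" for g h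
    proof -
      have "(1 / l) *\<^sub>R (f + B g) - (1 / l) *\<^sub>R (f + B h) = (1 / l) *\<^sub>R B (g - h)"
        by (simp add: scaleR_diff_right[symmetric] diff)
      moreover have "norm (B (g - h)) \<le> onorm B * norm (g - h)"
        by (rule onorm[OF bounded_linear])
      ultimately show ?thesis using l_pos by (simp add: dist_norm divide_right_mono)
    qed
  qed (use assms(2) in auto)
  then obtain g where g: "g \<in> S" "(1 / l) *\<^sub>R (f + B g) = g" by blast
  have "l *\<^sub>R g = f + B g" by (subst g(2)[symmetric]) (use l_pos in simp)
  hence "l *\<^sub>R g - B g = f" by simp
  thus thesis using g(1) that by blast
qed

lemma inj: "inj (\<lambda>f. l *\<^sub>R f - B f)"
proof (rule injI)
  fix g h assume "l *\<^sub>R g - B g = l *\<^sub>R h - B h"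
  hence "l *\<^sub>R (g - h) - B (g - h) = 0" by (simp add: diff algebra_simps)
  hence "(l - onorm B) * norm (g - h) \<le> 0" using norm_ge[of "g - h"] by simp
  thus "g = h" using onorm_less by (simp add: mult_le_0_iff)
qed

lemma surj: "surj (\<lambda>f. l *\<^sub>R f - B f)"
proof (rule surjI)
  fix f
  show "l *\<^sub>R (SOME g. l *\<^sub>R g - B g = f) - B (SOME g. l *\<^sub>R g - B g = f) = f"
    by (rule someI_ex, rule solution_in_closed[of UNIV f]) auto
qed

lemma resolvent_apply: "l *\<^sub>R resolvent B l f - B (resolvent B l f) = f"
  unfolding resolvent_def using surj_f_inv_f[OF surj, of f] by simp

lemma resolvent_eqI: "l *\<^sub>R g - B g = f \<Longrightarrow> resolvent B l f = g"
  unfolding resolvent_def using inv_f_f[OF inj, of g] by simp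

lemma norm_resolvent_le: "norm (resolvent B l f) \<le> 1 / (l - onorm B) * norm f"
  using norm_ge[of "resolvent B l f"] onorm_less
  by (simp add: resolvent_apply field_simps)

lemma boundedly_invertible: "boundedly_invertible_on UNIV (\<lambda>f. l *\<^sub>R f - B f)"
  unfolding boundedly_invertible_on_def
  using inj surj norm_resolvent_le unfolding resolvent_def by (blast intro: bijI)

lemma resolvent_diff: "resolvent B l (f - g) = resolvent B l f - resolvent B l g"
proof (rule resolvent_eqI)
  show "l *\<^sub>R (resolvent B l f - resolvent B l g) - B (resolvent B l f - resolvent B l g) = f - g"
    using resolvent_apply[of f] resolvent_apply[of g] by (simp add: diff algebra_simps) 
qed

text \<open>Since \<open>l\<close> is real, \<open>l - B\<close> moves across the inner product. A
  coordinate of the resolvent of \<open>g\<close> thereby becomes the inner product of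
  \<open>g\<close> with a Green function.\<close>

lemma cinner_resolvent:
  assumes "selfadjoint B"
  shows "cinner (resolvent B l f) g = cinner f (resolvent B l g)"
proof -
  let ?R = "resolvent B l"
  have sub: "cinner (l *\<^sub>R a - b) c = of_real l * cinner a c - cinner b c" for a b c :: "'a ell2"
    using cinner_add_left[of "l *\<^sub>R a - b" b c] by (simp add: cinner_scaleR_left)
  have sub': "cinner c (l *\<^sub>R a - b) = of_real l * cinner c a - cinner c b" for a b c :: "'a ell2"
    by (subst (1 2 3) cinner_commute) (simp add: sub)
  have "cinner (?R f) g = cinner (?R f) (l *\<^sub>R ?R g - B (?R g))"
    by (simp add: resolvent_apply)
  also have "\<dots> = cinner (l *\<^sub>R ?R f - B (?R f)) (?R g)"
    using assms by (simp add: sub sub' selfadjoint_def)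
  finally show ?thesis by (simp add: resolvent_apply)
qed

end

text \<open>The inverse of \<open>1 - P R\<^sub>0 P\<close> is \<open>1 + P R P\<close>, where \<open>R\<close> is the resolvent of \<open>A\<^sub>0 + P\<close>.\<close>

lemma resolvent_perturbation_by_projection:
  fixes A A\<^sub>0 D :: "'a ell2 \<Rightarrow> 'a ell2" and S :: "'a set" and l :: real
  defines "P \<equiv> restrict_ell2 S" and "M \<equiv> ell2_on S"
    and "R \<equiv> resolvent A l" and "R\<^sub>0 \<equiv> resolvent A\<^sub>0 l"
  assumes "resolvent_point A l" and "resolvent_point A\<^sub>0 l"
    and A: "\<And>f. A f = A\<^sub>0 f + P f"
    and D: "\<And>g. g \<in> M \<Longrightarrow> D g = g - P (R\<^sub>0 g)"
  shows "boundedly_invertible_on M D"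
    and "R f = R\<^sub>0 (f + P (inv_into M D (P (R\<^sub>0 f))))"
proof -
  interpret A: resolvent_point A l by fact
  interpret A0: resolvent_point A\<^sub>0 l by fact
  interpret P: bounded_linear P unfolding P_def by (rule bounded_linear_restrict_ell2)
  note PM = restrict_ell2_in[of S, folded P_def M_def]
  note Pid = restrict_ell2_id[where S = S, folded P_def M_def]
  \<comment> \<open>Two resolvent identities: \<open>R f\<close> solves the
    \<open>A\<^sub>0\<close>-equation with source \<open>f + P (R f)\<close>, and
    \<open>R\<^sub>0 f\<close> solves the \<open>A\<close>-equation with source
    \<open>f - P (R\<^sub>0 f)\<close>. The first gives \<open>D (E g) = g\<close>, the second
    \<open>E (D g) = g\<close>.\<close>
  have R: "R f = R\<^sub>0 (f + P (R f))" for f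
    using A.resolvent_apply[of f] unfolding R\<^sub>0_def R_def
    by (intro A0.resolvent_eqI[symmetric]) (simp add: A algebra_simps)
  have R': "R (f - P (R\<^sub>0 f)) = R\<^sub>0 f" for f
    using A0.resolvent_apply[of f] unfolding R\<^sub>0_def R_def
    by (intro A.resolvent_eqI) (simp add: A algebra_simps)
  define E where "E g = g + P (R g)" for g
  have DM: "D g \<in> M" if "g \<in> M" for g
    using that PM unfolding D[OF that] M_def by (intro ell2_on_diff) auto
  have EM: "E g \<in> M" if "g \<in> M" for g
    using that PM unfolding E_def M_def by (intro ell2_on_add) auto
  have DE: "D (E g) = g" if "g \<in> M" for g
    unfolding D[OF EM[OF that]] using R[of g] by (simp add: E_def)
  have ED: "E (D g) = g" if "g \<in> M" for g
    unfolding D[OF that] E_def R' by simp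
  have bij: "bij_betw D M M"
    by (rule bij_betw_byWitness[of _ E]) (use DE ED DM EM in auto)
  have inv: "inv_into M D g = E g" if "g \<in> M" for g
    using bij DE[OF that] EM[OF that] by (metis bij_betw_inv_into_left)
  obtain K where K: "\<And>g. norm (P g) \<le> norm g * K" "0 \<le> K"
    using P.nonneg_bounded by blast
  have "norm (inv_into M D g) \<le> (1 + 1 / (l - onorm A) * K) * norm g" if "g \<in> M" for g
  proof -
    have "norm (E g) \<le> norm g + norm (R g) * K"
      unfolding E_def using K(1) norm_triangle_le order_refl by (metis add_left_mono)
    also have "norm (R g) * K \<le> (1 / (l - onorm A) * norm g) * K"
      unfolding R_def by (intro mult_right_mono A.norm_resolvent_le K)
    finally show ?thesis by (simp add: inv[OF that] algebra_simps)
  qed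
  thus "boundedly_invertible_on M D" unfolding boundedly_invertible_on_def using bij by blast
  \<comment> \<open>By additivity of \<open>R\<close>, \<open>E\<close> applied to
    \<open>P (R\<^sub>0 f)\<close> is \<open>P\<close> of the left side, hence
    \<open>P (R f)\<close>.\<close>
  have "R\<^sub>0 f + R (P (R\<^sub>0 f)) = R f"
    using R'[of f] by (simp add: R_def A.resolvent_diff diff_eq_eq)
  hence "inv_into M D (P (R\<^sub>0 f)) = P (R f)"
    by (metis inv[OF PM] E_def P.add)
  thus "R f = R\<^sub>0 (f + P (inv_into M D (P (R\<^sub>0 f))))"
    using R[of f] Pid[OF PM] by simp
qed


section \<open>Schur test for adjacency operators\<close>

definition nbrs :: "'v graph \<Rightarrow> 'v \<Rightarrow> 'v set" where
  "nbrs X x = {y. adjacent X x y}"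

lemma adjacent_sym: "adjacent X x y \<Longrightarrow> adjacent X y x"
  by (simp add: adjacent_def insert_commute)

lemma nbrs_sym: "y \<in> nbrs X x \<longleftrightarrow> x \<in> nbrs X y"
  by (auto simp: nbrs_def adjacent_sym)

text \<open>The function \<phi> is a comparison weight with no summability required: it serves as
  Schur weight for the norm and as pointwise majorant for Green functions.\<close>

locale positive_supersolution =
  fixes X :: "'v graph" and \<phi> :: "'v \<Rightarrow> real" and L :: real
  assumes finite_nbrs: "finite (nbrs X x)"
    and pos: "0 < \<phi> x"
    and super: "(\<Sum>y\<in>nbrs X x. \<phi> y) \<le> L * \<phi> x"
begin

lemma L_nonneg: "0 \<le> L"
proof -
  have "0 \<le> (\<Sum>y\<in>nbrs X x. \<phi> y)" for x by (intro sum_nonneg less_imp_le pos)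
  hence "0 \<le> L * \<phi> undefined" using super order_trans by blast
  thus ?thesis using pos[of undefined] by (simp add: zero_le_mult_iff)
qed

text \<open>Cauchy-Schwarz for the splitting of \<open>h\<close> into \<open>sqrt (\<phi> y)\<close>
  times \<open>h y / sqrt (\<phi> y)\<close> produces one factor \<open>L\<close>; after exchanging
  the sums, symmetry of adjacency produces the second. Finite sums suffice, so square-summability of
  the image can be deduced from it.\<close>

lemma schur_test:
  assumes C: "\<And>F. finite F \<Longrightarrow> (\<Sum>x\<in>F. (h x)\<^sup>2) \<le> C" and F: "finite F"
  shows "(\<Sum>x\<in>F. (\<Sum>y\<in>nbrs X x. h y)\<^sup>2) \<le> L\<^sup>2 * C"
proof -
  define w where "w y = (h y)\<^sup>2 / \<phi> y" for y
  define G where "G = (\<Union>x\<in>F. nbrs X x)"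
  have G: "finite G" using F finite_nbrs by (simp add: G_def)
  have w: "0 \<le> w y" for y using pos[of y] by (simp add: w_def)
  have "(\<Sum>y\<in>nbrs X x. h y)\<^sup>2 \<le> L * \<phi> x * (\<Sum>y\<in>nbrs X x. w y)" for x
  proof -
    have "(\<Sum>y\<in>nbrs X x. h y)\<^sup>2 = (\<Sum>y\<in>nbrs X x. sqrt (\<phi> y) * (h y / sqrt (\<phi> y)))\<^sup>2"
      using pos by (simp add: less_imp_neq[symmetric])
    also have "\<dots> \<le> (\<Sum>y\<in>nbrs X x. (sqrt (\<phi> y))\<^sup>2) * (\<Sum>y\<in>nbrs X x. (h y / sqrt (\<phi> y))\<^sup>2)"
      by (rule Cauchy_Schwarz_ineq_sum)
    also have "\<dots> = (\<Sum>y\<in>nbrs X x. \<phi> y) * (\<Sum>y\<in>nbrs X x. w y)"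
      using pos by (simp add: w_def power_divide less_imp_le)
    also have "\<dots> \<le> L * \<phi> x * (\<Sum>y\<in>nbrs X x. w y)"
      by (intro mult_right_mono super sum_nonneg w)
    finally show ?thesis .
  qed
  hence "(\<Sum>x\<in>F. (\<Sum>y\<in>nbrs X x. h y)\<^sup>2) \<le> (\<Sum>x\<in>F. L * \<phi> x * (\<Sum>y\<in>nbrs X x. w y))"
    by (intro sum_mono)
  also have "\<dots> = (\<Sum>x\<in>F. \<Sum>y | y \<in> G \<and> y \<in> nbrs X x. L * \<phi> x * w y)"
    unfolding sum_distrib_left by (intro sum.cong refl) (auto simp: G_def)
  also have "\<dots> = (\<Sum>y\<in>G. \<Sum>x | x \<in> F \<and> y \<in> nbrs X x. L * \<phi> x * w y)"
    by (rule sum.swap_restrict[OF F G])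
  also have "\<dots> \<le> (\<Sum>y\<in>G. L\<^sup>2 * (h y)\<^sup>2)"
  proof (rule sum_mono)
    fix y
    have "(\<Sum>x | x \<in> F \<and> y \<in> nbrs X x. \<phi> x) \<le> (\<Sum>x\<in>nbrs X y. \<phi> x)"
      using nbrs_sym[of y X] pos by (intro sum_mono2 finite_nbrs) (auto intro: less_imp_le)
    also have "\<dots> \<le> L * \<phi> y" by (rule super)
    finally have "L * w y * (\<Sum>x | x \<in> F \<and> y \<in> nbrs X x. \<phi> x) \<le> L * w y * (L * \<phi> y)"
      by (intro mult_left_mono mult_nonneg_nonneg w L_nonneg)
    thus "(\<Sum>x | x \<in> F \<and> y \<in> nbrs X x. L * \<phi> x * w y) \<le> L\<^sup>2 * (h y)\<^sup>2"
      using pos[of y] by (simp add: w_def sum_distrib_left power2_eq_square mult_ac)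
  qed
  also have "\<dots> \<le> L\<^sup>2 * C"
    unfolding sum_distrib_left[symmetric] by (intro mult_left_mono C G) auto
  finally show ?thesis .
qed

lemma schur_test_coord:
  "finite F \<Longrightarrow> (\<Sum>x\<in>F. (\<Sum>y\<in>nbrs X x. cmod (coord f y))\<^sup>2) \<le> L\<^sup>2 * (norm f)\<^sup>2"
  by (intro schur_test sum_coord_le)

lemma square_summable_sum_nbrs: "square_summable (\<lambda>x. \<Sum>y\<in>nbrs X x. coord f y)"
proof (rule square_summableI)
  fix F :: "'v set" assume F: "finite F"
  have "(\<Sum>x\<in>F. (cmod (\<Sum>y\<in>nbrs X x. coord f y))\<^sup>2)
      \<le> (\<Sum>x\<in>F. (\<Sum>y\<in>nbrs X x. cmod (coord f y))\<^sup>2)"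
    by (intro sum_mono power_mono norm_sum) auto
  also note schur_test_coord[OF F]
  finally show "(\<Sum>x\<in>F. (cmod (\<Sum>y\<in>nbrs X x. coord f y))\<^sup>2) \<le> L\<^sup>2 * (norm f)\<^sup>2" .
qed

text \<open>\<open>Abs_ell2\<close> is specified only on square-summable functions, so the Schur
  estimate must precede this formula.\<close>

lemma coord_adjacency_op: "coord (adjacency_op X f) x = (\<Sum>y\<in>nbrs X x. coord f y)"
proof -
  have card: "card {e \<in> X. e = {x, y}} = (if y \<in> nbrs X x then 1 else 0)" for x y
  proof -
    have "{e \<in> X. e = {x, y}} = (if y \<in> nbrs X x then {{x, y}} else {})"
      by (auto simp: nbrs_def adjacent_def)
    thus ?thesis by simp
  qed
  have "(\<Sum>\<^sub>\<infinity>y. of_nat (card {e \<in> X. e = {x, y}}) * coord f y) = (\<Sum>\<^sub>\<infinity>y\<in>nbrs X x. coord f y)" for x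
    unfolding card by (rule infsum_cong_neutral) auto
  hence "adjacency_op X f = Abs_ell2 (\<lambda>x. \<Sum>y\<in>nbrs X x. coord f y)"
    unfolding adjacency_op_def matrix_op_def by (simp add: finite_nbrs)
  thus ?thesis by (simp add: Abs_ell2_inverse square_summable_sum_nbrs)
qed

lemma norm_adjacency_op_le: "norm (adjacency_op X f) \<le> L * norm f"
proof (rule norm_ell2_leI)
  fix F :: "'v set" assume F: "finite F"
  have "(\<Sum>x\<in>F. (cmod (coord (adjacency_op X f) x))\<^sup>2)
      \<le> (\<Sum>x\<in>F. (\<Sum>y\<in>nbrs X x. cmod (coord f y))\<^sup>2)"
    unfolding coord_adjacency_op by (intro sum_mono power_mono norm_sum) auto
  also note schur_test_coord[OF F]
  finally show "(\<Sum>x\<in>F. (cmod (coord (adjacency_op X f) x))\<^sup>2) \<le> (L * norm f)\<^sup>2"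
    by (simp add: power_mult_distrib)
qed (simp add: L_nonneg)

lemma bounded_linear_adjacency_op: "bounded_linear (adjacency_op X)"
proof (rule bounded_linear_intro)
  show "norm (adjacency_op X f) \<le> norm f * L" for f
    using norm_adjacency_op_le[of f] by (simp add: mult.commute)
qed (rule ell2_eqI, simp add: coord_adjacency_op sum.distrib sum_distrib_left)+

lemma onorm_adjacency_op_le: "onorm (adjacency_op X) \<le> L"
  by (rule onorm_bound[OF L_nonneg norm_adjacency_op_le])

text \<open>By symmetry of adjacency both sides are the double sum of \<open>k\<close>, taken in the
  two orders. The exchange needs absolute summability, which follows from
  \<open>s * t \<le> s\<^sup>2 + t\<^sup>2\<close> for nonnegative \<open>s\<close>,
  \<open>t\<close> and the Schur test.\<close>

lemma selfadjoint_adjacency_op: "selfadjoint (adjacency_op X)"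
  unfolding selfadjoint_def
proof (intro allI)
  fix f g :: "'v ell2"
  define k where "k x y = (if y \<in> nbrs X x then coord f y * cnj (coord g x) else 0)" for x y
  have bound: "(\<Sum>p\<in>F. norm (case p of (x, y) \<Rightarrow> k x y)) \<le> (norm g)\<^sup>2 + L\<^sup>2 * (norm f)\<^sup>2"
    if F: "finite F" for F
  proof -
    let ?A = "fst ` F" and ?B = "snd ` F"
    have fin: "finite ?A" "finite ?B" using F by auto
    have "(\<Sum>p\<in>F. norm (case p of (x, y) \<Rightarrow> k x y)) \<le> (\<Sum>p\<in>?A \<times> ?B. norm (case p of (x, y) \<Rightarrow> k x y))"
      using fin by (intro sum_mono2) (auto intro: rev_image_eqI)
    also have "\<dots> = (\<Sum>x\<in>?A. \<Sum>y\<in>?B. norm (k x y))"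
      by (simp add: sum.cartesian_product case_prod_unfold)
    also have "\<dots> \<le> (\<Sum>x\<in>?A. (cmod (coord g x))\<^sup>2 + (\<Sum>y\<in>nbrs X x. cmod (coord f y))\<^sup>2)"
    proof (rule sum_mono)
      fix x
      let ?s = "\<Sum>y\<in>nbrs X x. cmod (coord f y)"
      have "(\<Sum>y\<in>?B. norm (k x y)) = (\<Sum>y\<in>?B \<inter> nbrs X x. cmod (coord f y) * cmod (coord g x))"
        using fin unfolding k_def
        by (subst sum.inter_restrict) (auto intro!: sum.cong simp: norm_mult)
      also have "\<dots> \<le> (\<Sum>y\<in>nbrs X x. cmod (coord f y) * cmod (coord g x))"
        using finite_nbrs by (intro sum_mono2) auto
      also have "\<dots> = ?s * cmod (coord g x)" by (simp add: sum_distrib_right)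
      also have "\<dots> \<le> (cmod (coord g x))\<^sup>2 + ?s\<^sup>2"
      proof -
        have "0 \<le> ?s * cmod (coord g x)" by (intro mult_nonneg_nonneg sum_nonneg) auto
        moreover have "2 * (?s * cmod (coord g x)) \<le> (cmod (coord g x))\<^sup>2 + ?s\<^sup>2"
          using zero_le_power2[of "cmod (coord g x) - ?s"] by (simp add: power2_diff mult_ac)
        ultimately show ?thesis by linarith
      qed
      finally show "(\<Sum>y\<in>?B. norm (k x y)) \<le> (cmod (coord g x))\<^sup>2 + ?s\<^sup>2" .
    qed
    also have "\<dots> \<le> (norm g)\<^sup>2 + L\<^sup>2 * (norm f)\<^sup>2"
      unfolding sum.distrib by (intro add_mono sum_coord_le schur_test_coord fin)
    finally show ?thesis .
  qed
  have "(\<lambda>p. norm (case p of (x, y) \<Rightarrow> k x y)) summable_on UNIV"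
    by (rule nonneg_bdd_above_summable_on) (use bound in \<open>auto intro!: bdd_aboveI\<close>)
  hence swap: "(\<Sum>\<^sub>\<infinity>x. \<Sum>\<^sub>\<infinity>y. k x y) = (\<Sum>\<^sub>\<infinity>y. \<Sum>\<^sub>\<infinity>x. k x y)"
    by (rule infsum_swap_banach[OF abs_summable_summable, of k UNIV UNIV, unfolded UNIV_Times_UNIV])
  have left: "(\<Sum>\<^sub>\<infinity>y. k x y) = coord (adjacency_op X f) x * cnj (coord g x)" for x
  proof -
    have "(\<Sum>\<^sub>\<infinity>y. k x y) = (\<Sum>\<^sub>\<infinity>y\<in>nbrs X x. coord f y * cnj (coord g x))"
      unfolding k_def by (rule infsum_cong_neutral) auto
    thus ?thesis by (simp add: finite_nbrs coord_adjacency_op sum_distrib_right)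
  qed
  have right: "(\<Sum>\<^sub>\<infinity>x. k x y) = coord f y * cnj (coord (adjacency_op X g) y)" for y
  proof -
    have "(\<Sum>\<^sub>\<infinity>x. k x y) = (\<Sum>\<^sub>\<infinity>x\<in>nbrs X y. coord f y * cnj (coord g x))"
      unfolding k_def by (rule infsum_cong_neutral) (auto simp: nbrs_sym)
    thus ?thesis by (simp add: finite_nbrs coord_adjacency_op sum_distrib_left)
  qed
  show "cinner (adjacency_op X f) g = cinner f (adjacency_op X g)"
    using swap by (simp only: left right cinner_def)
qed

text \<open>A maximum principle: iterating \<open>l h = A h\<close> improves the bound on \<open>h / \<phi>\<close> by the
  factor \<open>L / l\<close> each time.\<close>

lemma eigenfunction_eq_0:
  fixes h :: "'v \<Rightarrow> complex"
  assumes "L < l" and eq: "\<And>x. of_real l * h x = (\<Sum>y\<in>nbrs X x. h y)"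
    and bound: "\<And>x. cmod (h x) \<le> C * \<phi> x"
  shows "h x = 0"
proof -
  have l: "0 < l" using \<open>L < l\<close> L_nonneg by simp
  have "cmod (h x) \<le> C * (L / l) ^ n * \<phi> x" for n x
  proof (induction n arbitrary: x)
    case (Suc n)
    have "l * cmod (h x) = cmod (\<Sum>y\<in>nbrs X x. h y)"
      using l by (simp flip: eq add: norm_mult)
    also have "\<dots> \<le> (\<Sum>y\<in>nbrs X x. C * (L / l) ^ n * \<phi> y)"
      by (rule sum_norm_le) (rule Suc)
    also have "\<dots> \<le> C * (L / l) ^ n * (L * \<phi> x)"
      unfolding sum_distrib_left[symmetric]
    proof (rule mult_left_mono[OF super])
      have "0 \<le> C * \<phi> x" using bound[of x] norm_ge_zero order_trans by blast
      hence "0 \<le> C" using pos[of x] by (simp add: zero_le_mult_iff)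
      thus "0 \<le> C * (L / l) ^ n" using L_nonneg l by simp
    qed
    finally show ?case using l by (simp add: field_simps)
  qed (use bound in simp)
  moreover have "(\<lambda>n. C * (L / l) ^ n * \<phi> x) \<longlonglongrightarrow> C * 0 * \<phi> x"
    by (intro tendsto_intros LIMSEQ_realpow_zero) (use L_nonneg l \<open>L < l\<close> in auto)
  ultimately have "cmod (h x) \<le> C * 0 * \<phi> x" by (intro LIMSEQ_le_const) auto
  thus ?thesis by simp
qed

section \<open>Green functions of the adjacency operator\<close>

lemma resolvent_point: "L < l \<Longrightarrow> resolvent_point (adjacency_op X) l"
  using bounded_linear_adjacency_op onorm_adjacency_op_le
  by (intro resolvent_point.intro) auto

lemma resolvent_delta_bound:
  assumes "L < l"
  shows "cmod (coord (resolvent (adjacency_op X) l (delta x)) z) \<le> \<phi> z / (\<phi> x * (l - L))"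
proof -
  interpret resolvent_point "adjacency_op X" l by (rule resolvent_point[OF assms])
  \<comment> \<open>Chosen so that \<open>C * (l - L) * \<phi> x = 1\<close>: the source is then at
    most \<open>C * (l - L) * \<phi>\<close> and the neighbour sum at most
    \<open>C * L * \<phi>\<close>, which add up to \<open>C * l * \<phi>\<close>, so
    \<open>S\<close> is invariant.\<close>
  define C where "C = 1 / (\<phi> x * (l - L))"
  define S where "S = {f. \<forall>z. cmod (coord f z) \<le> C * \<phi> z}"
  have C: "0 \<le> C" using pos[of x] assms by (simp add: C_def)
  have cont: "continuous_on UNIV (\<lambda>f. coord f z)" for z :: 'v
  proof (rule linear_continuous_on, rule bounded_linear_intro)
    show "norm (coord f z) \<le> norm f * 1" for f using norm_coord_le[of f z] by simp
  qed (simp_all add: scaleR_conv_of_real)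
  have "closed S"
    unfolding S_def by (intro closed_Collect_all closed_Collect_le continuous_intros cont)
  moreover have "0 \<in> S" using C pos by (simp add: S_def less_imp_le)
  hence "S \<noteq> {}" by blast
  moreover have "(1 / l) *\<^sub>R (delta x + adjacency_op X g) \<in> S" if g: "g \<in> S" for g
    unfolding S_def
  proof (intro CollectI allI)
    fix z
    have "cmod (coord (delta x) z) \<le> C * (l - L) * \<phi> z"
      using assms pos[of x] pos[of z] by (simp add: delta.rep_eq C_def)
    moreover have "cmod (\<Sum>y\<in>nbrs X z. coord g y) \<le> C * (L * \<phi> z)"
    proof -
      have "cmod (\<Sum>y\<in>nbrs X z. coord g y) \<le> (\<Sum>y\<in>nbrs X z. C * \<phi> y)"
        using g by (intro sum_norm_le) (simp add: S_def)
      also have "\<dots> \<le> C * (L * \<phi> z)"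
        unfolding sum_distrib_left[symmetric] by (rule mult_left_mono[OF super C])
      finally show ?thesis .
    qed
    ultimately have "cmod (coord (delta x) z + (\<Sum>y\<in>nbrs X z. coord g y)) \<le> C * l * \<phi> z"
      using norm_triangle_ineq[of "coord (delta x) z" "\<Sum>y\<in>nbrs X z. coord g y"]
      by (simp add: algebra_simps)
    thus "cmod (coord ((1 / l) *\<^sub>R (delta x + adjacency_op X g)) z) \<le> C * \<phi> z"
      using l_pos by (simp add: coord_adjacency_op norm_divide divide_simps mult_ac)
  qed
  ultimately obtain g where "g \<in> S" "l *\<^sub>R g - adjacency_op X g = delta x"
    using solution_in_closed by blast
  hence "resolvent (adjacency_op X) l (delta x) \<in> S" using resolvent_eqI by metis
  thus ?thesis by (simp add: S_def C_def)
qed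

text \<open>The difference between the guess and the true Green function solves the homogeneous
  equation and is dominated by a multiple of \<phi>, hence vanishes by
  \<open>eigenfunction_eq_0\<close>.\<close>

lemma resolvent_delta_eqI:
  fixes h :: "'v \<Rightarrow> real"
  assumes "L < l" and eq: "\<And>z. l * h z - (\<Sum>y\<in>nbrs X z. h y) = (if z = x then 1 else 0)"
    and bound: "\<And>z. \<bar>h z\<bar> \<le> C * \<phi> z"
  shows "coord (resolvent (adjacency_op X) l (delta x)) z = of_real (h z)"
proof -
  interpret resolvent_point "adjacency_op X" l by (rule resolvent_point[OF assms(1)])
  define r where "r = resolvent (adjacency_op X) l (delta x)"
  define d where "d z = coord r z - of_real (h z)" for z
  have "d z = 0"
  proof (rule eigenfunction_eq_0[OF assms(1)])
    fix z
    have "coord (l *\<^sub>R r - adjacency_op X r) z = (if z = x then 1 else 0)"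
      unfolding r_def resolvent_apply by (simp add: delta.rep_eq)
    hence "of_real l * coord r z - (\<Sum>y\<in>nbrs X z. coord r y) = (if z = x then 1 else 0)"
      by (simp add: coord_adjacency_op)
    also have "\<dots> = of_real (l * h z - (\<Sum>y\<in>nbrs X z. h y))" by (simp add: eq)
    finally show "of_real l * d z = (\<Sum>y\<in>nbrs X z. d y)"
      by (simp add: d_def sum_subtractf algebra_simps)
    show "cmod (d z) \<le> (1 / (\<phi> x * (l - L)) + C) * \<phi> z"
      using norm_triangle_ineq4[of "coord r z" "of_real (h z)"] bound[of z]
        resolvent_delta_bound[OF assms(1), of x z]
      by (simp add: d_def r_def algebra_simps)
  qed
  thus ?thesis by (simp add: d_def r_def)
qed

end


section \<open>The nearest-point projection onto a subtree\<close>

lemma rtranclp_distinct_path: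
  assumes "r\<^sup>*\<^sup>* a b"
  shows "\<exists>p. p \<noteq> [] \<and> hd p = a \<and> last p = b \<and> distinct p \<and> successively r p"
  using assms
proof (induction rule: converse_rtranclp_induct)
  case base
  show ?case by (rule exI[of _ "[b]"]) simp
next
  case (step a c)
  then obtain p where p: "p \<noteq> []" "hd p = c" "last p = b" "distinct p" "successively r p"
    by blast
  show ?case
  proof (cases "a \<in> set p")
    case True
    \<comment> \<open>If \<open>a\<close> already lies on the path from \<open>c\<close>, the part
      of that path from \<open>a\<close> onwards is the desired one.\<close>
    then obtain q q' where "p = q @ a # q'" by (meson split_list)
    thus ?thesis using p by (intro exI[of _ "a # q'"]) (auto simp: successively_append_iff)
  next
    case False
    thus ?thesis using p step(1)
      by (intro exI[of _ "a # p"]) (auto simp: successively_Cons)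
  qed
qed

text \<open>Otherwise a path without repetitions from \<open>a\<close> to \<open>b\<close> avoiding
  \<open>x\<close> would close up through \<open>x\<close> to a cycle.\<close>

lemma tree_nbrs_separated:
  assumes "tree X" and ab: "adjacent X x a" "adjacent X x b"
    and path: "(\<lambda>y z. adjacent X y z \<and> y \<noteq> x \<and> z \<noteq> x)\<^sup>*\<^sup>* a b"
  shows "a = b"
proof (rule ccontr)
  assume "a \<noteq> b"
  obtain p where p: "p \<noteq> []" "hd p = a" "last p = b" "distinct p"
    "successively (\<lambda>y z. adjacent X y z \<and> y \<noteq> x \<and> z \<noteq> x) p"
    using rtranclp_distinct_path[OF path] by blast
  have len: "2 \<le> length p"
    using p(1-3) \<open>a \<noteq> b\<close> by (cases p; cases "tl p") auto
  have step: "adjacent X (p ! i) (p ! Suc i) \<and> p ! i \<noteq> x \<and> p ! Suc i \<noteq> x" if "Suc i < length p" for i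
    using p(5) that by (simp add: successively_conv_nth)
  \<comment> \<open>The final vertex starts no step, so it is handled as the endpoint of the last
    one.\<close>
  have "p ! i \<noteq> x" if "i < length p" for i
  proof (cases "Suc i < length p")
    case False
    hence "i = Suc (length p - 2)" using that len by linarith
    thus ?thesis using step[of "length p - 2"] len by simp
  qed (use step in blast)
  hence x: "x \<notin> set p" by (auto simp: in_set_conv_nth)
  have "adjacent X ((x # p) ! i) ((x # p) ! (Suc i mod length (x # p)))" if "i < length (x # p)" for i
  proof (cases i)
    case 0
    thus ?thesis using ab(1) p(1,2) by (simp add: hd_conv_nth)
  next
    case (Suc j)
    show ?thesis
    proof (cases "Suc j = length p")
      case True
      hence "p ! j = b" using p(1,3) by (metis diff_Suc_1 last_conv_nth)
      thus ?thesis using Suc adjacent_sym[OF ab(2)] by (simp add: True[symmetric])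
    next
      case False
      thus ?thesis using that Suc step[of j] by simp
    qed
  qed
  hence "is_cycle X (x # p)" using len x p(4) by (simp add: is_cycle_def)
  thus False using \<open>tree X\<close> by (auto simp: tree_def)
qed

lemma card_nbrs: "graph X \<Longrightarrow> card (nbrs X x) = degree X x"
  unfolding degree_def
proof (rule bij_betw_same_card[of "\<lambda>y. {x, y}"], rule bij_betw_imageI)
  show "inj_on (\<lambda>y. {x, y}) (nbrs X x)" by (rule inj_onI) (auto simp: doubleton_eq_iff)
  assume "graph X"
  thus "(\<lambda>y. {x, y}) ` nbrs X x = {e \<in> X. x \<in> e}"
    by (fastforce simp: graph_def nbrs_def adjacent_def insert_commute)
qed

text \<open>Instantiated both with the looped path and with singletons; for a singleton
  \<open>depth\<close> is the graph distance, so one set of neighbour sums serves both Green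
  functions.\<close>

locale subtree =
  fixes X :: "'v graph" and S :: "'v set"
  assumes tree: "tree X"
    and finite_nbrs: "finite (nbrs X x)"
    and nonempty: "S \<noteq> {}"
    and connected: "s \<in> S \<Longrightarrow> t \<in> S \<Longrightarrow> (\<lambda>y z. adjacent X y z \<and> y \<in> S \<and> z \<in> S)\<^sup>*\<^sup>* s t"
begin

definition depth :: "'v \<Rightarrow> nat" where
  "depth x = (LEAST n. \<exists>s\<in>S. (adjacent X ^^ n) s x)"

lemma depth_path: "\<exists>s\<in>S. (adjacent X ^^ depth x) s x"
  unfolding depth_def
proof (rule LeastI_ex)
  obtain s where "s \<in> S" using nonempty by blast
  moreover have "(adjacent X)\<^sup>*\<^sup>* s x" using tree by (simp add: tree_def connected_graph_def)
  ultimately show "\<exists>n. \<exists>s\<in>S. (adjacent X ^^ n) s x" by (metis rtranclp_imp_relpowp)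
qed

lemma depth_le: "s \<in> S \<Longrightarrow> (adjacent X ^^ n) s x \<Longrightarrow> depth x \<le> n"
  unfolding depth_def by (rule Least_le) blast

lemma depth_eq_0_iff: "depth x = 0 \<longleftrightarrow> x \<in> S"
  using depth_path[of x] depth_le[of x 0 x] by auto

lemma depth_adjacent: "adjacent X x y \<Longrightarrow> depth y \<le> Suc (depth x)"
  using depth_path[of x] by (metis depth_le relpowp_Suc_I)

lemma nbr_closer:
  assumes "x \<notin> S" shows "\<exists>y\<in>nbrs X x. depth y < depth x"
proof -
  obtain n where n: "depth x = Suc n" using assms depth_eq_0_iff[of x] by (cases "depth x") auto
  then obtain s y where "s \<in> S" "(adjacent X ^^ n) s y" "adjacent X y x"
    using depth_path[of x] by (auto elim: relpowp_Suc_E)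
  thus ?thesis using depth_le n adjacent_sym by (fastforce simp: nbrs_def)
qed

text \<open>Repeatedly pass to a closer neighbour: depth drops below that of \<open>x\<close>, so
  \<open>x\<close> is never met.\<close>

lemma path_to_S_avoiding:
  assumes "x \<notin> S" "a \<noteq> x" "depth a \<le> depth x"
  shows "\<exists>s\<in>S. (\<lambda>y z. adjacent X y z \<and> y \<noteq> x \<and> z \<noteq> x)\<^sup>*\<^sup>* a s"
  using assms(2,3)
proof (induction "depth a" arbitrary: a rule: less_induct)
  case less
  show ?case
  proof (cases "a \<in> S")
    case False
    then obtain b where b: "adjacent X a b" "depth b < depth a"
      using nbr_closer by (auto simp: nbrs_def)
    have "b \<noteq> x" "depth b \<le> depth x" using b(2) less.prems(2) by auto
    then obtain s where s: "s \<in> S" "(\<lambda>y z. adjacent X y z \<and> y \<noteq> x \<and> z \<noteq> x)\<^sup>*\<^sup>* b s"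
      using less.hyps[OF b(2)] by blast
    have "(\<lambda>y z. adjacent X y z \<and> y \<noteq> x \<and> z \<noteq> x)\<^sup>*\<^sup>* a s"
      by (rule converse_rtranclp_into_rtranclp[OF _ s(2)]) (use b less.prems \<open>b \<noteq> x\<close> in simp)
    thus ?thesis using s(1) by blast
  qed blast
qed

text \<open>Descending paths from \<open>a\<close> and \<open>b\<close>, joined inside
  \<open>S\<close>, connect them without meeting \<open>x\<close>. The weak inequalities also
  exclude neighbours at the same depth as \<open>x\<close>.\<close>

lemma nbr_closer_unique:
  assumes x: "x \<notin> S" and "a \<in> nbrs X x" "b \<in> nbrs X x" "depth a \<le> depth x" "depth b \<le> depth x"
  shows "a = b"
proof (rule tree_nbrs_separated[OF tree])
  let ?r = "\<lambda>y z. adjacent X y z \<and> y \<noteq> x \<and> z \<noteq> x"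
  show ab: "adjacent X x a" "adjacent X x b" using assms by (auto simp: nbrs_def)
  have "\<not> adjacent X x x" using tree by (simp add: tree_def loopless_def adjacent_def)
  hence ne: "a \<noteq> x" "b \<noteq> x" using ab by auto
  obtain s t where s: "s \<in> S" "?r\<^sup>*\<^sup>* a s" and t: "t \<in> S" "?r\<^sup>*\<^sup>* b t"
    using path_to_S_avoiding[OF x] ne assms(4,5) by blast
  have "?r\<^sup>*\<^sup>* s t"
    using connected[OF s(1) t(1)] by (rule rtranclp_mono[THEN predicate2D, rotated]) (use x in auto)
  moreover have "?r\<^sup>*\<^sup>* t b"
  proof -
    have "symp ?r" by (auto intro: sympI adjacent_sym)
    hence "symp ?r\<^sup>*\<^sup>*" by (rule symp_rtranclp)
    thus ?thesis using t(2) by (rule sympD)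
  qed
  ultimately show "?r\<^sup>*\<^sup>* a b" using s(2) by (meson rtranclp_trans)
qed

section \<open>Parents, projection and neighbour sums\<close>

definition parent :: "'v \<Rightarrow> 'v" where
  "parent x = (THE y. y \<in> nbrs X x \<and> depth y < depth x)"

text \<open>Each parent step lowers the depth by one, so \<open>depth x\<close> steps end in
  \<open>S\<close>. On \<open>S\<close>, where \<open>parent\<close> is unspecified, no step is
  taken.\<close>

definition proj :: "'v \<Rightarrow> 'v" where
  "proj x = (parent ^^ depth x) x"

lemma parent_eqI: "y \<in> nbrs X x \<Longrightarrow> depth y < depth x \<Longrightarrow> parent x = y"
  unfolding parent_def using depth_eq_0_iff[of x]
  by (intro the_equality) (auto intro: nbr_closer_unique)

lemma parent: "x \<notin> S \<Longrightarrow> parent x \<in> nbrs X x" "x \<notin> S \<Longrightarrow> depth x = Suc (depth (parent x))"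
proof -
  assume "x \<notin> S"
  then obtain y where y: "y \<in> nbrs X x" "depth y < depth x" using nbr_closer by blast
  thus "parent x \<in> nbrs X x" using parent_eqI by blast
  have "depth x \<le> Suc (depth y)"
    using y(1) by (intro depth_adjacent) (simp add: nbrs_def adjacent_sym)
  thus "depth x = Suc (depth (parent x))" using y parent_eqI by fastforce
qed

lemma proj_in: "x \<in> S \<Longrightarrow> proj x = x"
  using depth_eq_0_iff[of x] by (simp add: proj_def)

lemma proj_parent: "x \<notin> S \<Longrightarrow> proj (parent x) = proj x"
  by (simp add: proj_def parent(2) funpow_swap1)

lemma nbr_away:
  assumes "y \<in> nbrs X x" "x \<in> S \<and> y \<notin> S \<or> x \<notin> S \<and> y \<noteq> parent x"
  shows "depth y = Suc (depth x)" and "proj y = proj x"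
proof -
  have less: "depth x < depth y"
  proof (cases "x \<in> S")
    case True
    thus ?thesis using assms(2) depth_eq_0_iff[of x] depth_eq_0_iff[of y] by auto
  next
    case False
    have "\<not> depth y \<le> depth x"
    proof
      assume "depth y \<le> depth x"
      hence "y = parent x"
        using False parent[OF False] assms(1) by (intro nbr_closer_unique[of x]) auto
      thus False using assms(2) False by blast
    qed
    thus ?thesis by simp
  qed
  have y: "y \<notin> S" using less depth_eq_0_iff[of y] by auto
  have "parent y = x" using assms(1) less by (intro parent_eqI) (simp_all add: nbrs_sym)
  thus "depth y = Suc (depth x)" "proj y = proj x" using parent(2)[OF y] proj_parent[OF y] by auto
qed

text \<open>All neighbours share the projection of \<open>x\<close>; the parent contributes the
  factor \<open>1 / u\<close> and every other neighbour \<open>u\<close>. So the eigenvalue equation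
  off \<open>S\<close> holds whatever \<open>c\<close> is, and only an equation for \<open>c\<close>
  on \<open>S\<close> remains.\<close>

lemma sum_nbrs_outside:
  fixes u :: real
  assumes "x \<notin> S" "u \<noteq> 0"
  shows "(\<Sum>y\<in>nbrs X x. c (proj y) * u ^ depth y)
    = (1 / u + (real (card (nbrs X x)) - 1) * u) * (c (proj x) * u ^ depth x)"
proof -
  let ?N = "nbrs X x - {parent x}"
  have "(\<Sum>y\<in>nbrs X x. c (proj y) * u ^ depth y)
      = c (proj x) * u ^ depth (parent x) + (\<Sum>y\<in>?N. c (proj y) * u ^ depth y)"
    using parent(1)[OF assms(1)] finite_nbrs by (subst sum.remove) (auto simp: proj_parent assms)
  also have "(\<Sum>y\<in>?N. c (proj y) * u ^ depth y) = (\<Sum>y\<in>?N. c (proj x) * (u * u ^ depth x))"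
    using nbr_away assms(1) by (intro sum.cong) auto
  also have "u ^ depth (parent x) = u ^ depth x / u"
    using parent(2)[OF assms(1)] assms(2) by simp
  also have "(\<Sum>y\<in>?N. c (proj x) * (u * u ^ depth x))
      = (real (card (nbrs X x)) - 1) * (c (proj x) * (u * u ^ depth x))"
    using card.remove[OF finite_nbrs parent(1)[OF assms(1)]] by simp
  finally show ?thesis by (simp add: field_simps)
qed

lemma sum_nbrs_inside:
  fixes u :: real
  assumes "x \<in> S"
  shows "(\<Sum>y\<in>nbrs X x. c (proj y) * u ^ depth y)
    = (\<Sum>y\<in>nbrs X x \<inter> S. c y) + (real (card (nbrs X x)) - real (card (nbrs X x \<inter> S))) * u * c x"
proof -
  have dx: "depth x = 0" using assms by (simp add: depth_eq_0_iff)
  have "(\<Sum>y\<in>nbrs X x. c (proj y) * u ^ depth y)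
      = (\<Sum>y\<in>nbrs X x \<inter> S. c (proj y) * u ^ depth y) + (\<Sum>y\<in>nbrs X x - S. c (proj y) * u ^ depth y)"
    using finite_nbrs by (rule sum.Int_Diff)
  also have "(\<Sum>y\<in>nbrs X x \<inter> S. c (proj y) * u ^ depth y) = (\<Sum>y\<in>nbrs X x \<inter> S. c y)"
    using depth_eq_0_iff[THEN iffD2] by (intro sum.cong) (auto simp: proj_in)
  also have "(\<Sum>y\<in>nbrs X x - S. c (proj y) * u ^ depth y) = (\<Sum>y\<in>nbrs X x - S. u * c x)"
    using nbr_away[of _ x] assms by (intro sum.cong) (auto simp: dx proj_in)
  also have "\<dots> = (real (card (nbrs X x)) - real (card (nbrs X x \<inter> S))) * u * c x"
    using finite_nbrs
    by (simp add: card_Diff_subset_Int of_nat_diff card_mono)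
  finally show ?thesis .
qed

end


section \<open>The branching weights\<close>

text \<open>The smaller root of \<open>u + 1 / u = 3\<close>, the condition that makes \<phi> an
  eigenfunction also on the looped path.\<close>

definition u_star :: real where
  "u_star = (3 - sqrt 5) / 2"

text \<open>The base of the power in \<open>W_entry\<close> at \<open>1 / l\<close>: the decay rate
  of the Green functions along branches.\<close>

definition u_of :: "nat \<Rightarrow> real \<Rightarrow> real" where
  "u_of Q l = (1 - sqrt (1 - 4 * (real Q - 1) * (1 / l)\<^sup>2)) / (2 * (real Q - 1) * (1 / l))"

lemma u_star_root: "u_star\<^sup>2 = 3 * u_star - 1"
  by (simp add: u_star_def power2_eq_square field_simps)

lemma u_star_bounds: "0 < u_star" "u_star < 2 / 5"
proof -
  have "sqrt 5 < 3" by (rule real_less_lsqrt) auto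
  moreover have "11 / 5 < sqrt 5" by (rule real_less_rsqrt) (simp add: power2_eq_square)
  ultimately show "0 < u_star" "u_star < 2 / 5" by (simp_all add: u_star_def)
qed

lemma inverse_u_star: "1 / u_star = 3 - u_star"
  using u_star_root u_star_bounds by (simp add: field_simps power2_eq_square)

lemma lambda_star_eq: "lambda_star Q = 1 / u_star + (real Q - 1) * u_star"
  unfolding inverse_u_star by (simp add: lambda_star_def u_star_def field_simps)

text \<open>The arithmetic-geometric mean inequality for the two summands of
  \<open>lambda_star_eq\<close>; it makes the radicand in \<open>u_of\<close> positive beyond
  \<open>lambda_star Q\<close>.\<close>

lemma lambda_star_sq_ge: "4 * (real Q - 1) \<le> (lambda_star Q)\<^sup>2"
proof -
  have "(lambda_star Q)\<^sup>2 - 4 * (real Q - 1) = (1 / u_star - (real Q - 1) * u_star)\<^sup>2"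
    using u_star_bounds by (simp add: lambda_star_eq power2_eq_square field_simps)
  thus ?thesis by (metis diff_ge_0_iff_ge zero_le_power2)
qed

lemma lambda_star_pos: "1 \<le> Q \<Longrightarrow> 0 < lambda_star Q"
  using u_star_bounds by (simp add: lambda_star_eq add_pos_nonneg)

text \<open>Up to the factor \<open>l\<close>, the entry is the Green function of the tree, whose
  normalising constant is \<open>l - real Q * u_of Q l\<close>.\<close>

lemma W_entry_eq:
  assumes "3 \<le> Q" "l \<noteq> 0"
  shows "W_entry Q (1 / l) d = l * (u_of Q l ^ d / (l - real Q * u_of Q l))"
proof -
  define q where "q = real Q - 1"
  define s where "s = sqrt (1 - 4 * q * (1 / l)\<^sup>2)"
  have q: "q \<noteq> 0" "real Q = q + 1" using assms(1) by (auto simp: q_def)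
  have u: "u_of Q l = (1 - s) * l / (2 * q)"
    using assms(2) by (simp add: u_of_def flip: q_def s_def)
  have den: "l - real Q * u_of Q l = l * (real Q - 2 + real Q * s) / (2 * q)"
    using q by (simp add: u field_simps)
  have "l * (u_of Q l ^ d / (l - real Q * u_of Q l))
      = u_of Q l ^ d * (2 * q / (real Q - 2 + real Q * s))"
    unfolding den using q(1) assms(2) by simp
  thus ?thesis by (simp add: W_entry_def u_of_def flip: q_def s_def)
qed

text \<open>\<open>u_of Q l\<close> is the smaller root of \<open>(Q - 1) u\<^sup>2 - l u + 1\<close>, and this polynomial is negative
  at \<open>u_star\<close> for \<open>l > lambda_star Q\<close>.\<close>

lemma u_of_bounds:
  assumes "3 \<le> Q" "lambda_star Q < l"
  shows "0 < u_of Q l" "u_of Q l < u_star" "1 / u_of Q l + (real Q - 1) * u_of Q l = l"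
proof -
  define q where "q = real Q - 1"
  define s where "s = sqrt (1 - 4 * q * (1 / l)\<^sup>2)"
  define u where "u = u_of Q l"
  have q: "q > 0" using assms(1) by (auto simp: q_def)
  have l: "l > 0" using lambda_star_pos[of Q] assms by simp
  have "4 * q < l\<^sup>2"
    using lambda_star_sq_ge[of Q] lambda_star_pos[of Q] power_strict_mono[OF assms(2), of 2] assms(1)
    by (simp add: q_def)
  hence s: "0 < s" "s < 1" "s\<^sup>2 = 1 - 4 * q / l\<^sup>2"
    using q l by (auto simp: s_def power_divide)
  have u: "u = (1 - s) * l / (2 * q)"
    using l by (simp add: u_of_def u_def flip: q_def s_def)
  show pos: "0 < u_of Q l" using s q l by (simp add: u flip: u_def)
  have "q * u\<^sup>2 - l * u + 1 = l\<^sup>2 / (4 * q) * (s\<^sup>2 - 1) + 1"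
    using q by (simp add: u field_simps power2_eq_square)
  also have "\<dots> = 0" unfolding s(3) using q l by simp
  finally have root: "q * u\<^sup>2 - l * u + 1 = 0" .
  have "u * (1 / u + q * u) = u * l"
    using root pos by (simp add: u_def[symmetric] algebra_simps power2_eq_square)
  thus "1 / u_of Q l + (real Q - 1) * u_of Q l = l"
    using pos by (simp flip: u_def q_def)
  show "u_of Q l < u_star"
  proof (rule ccontr)
    assume "\<not> u_of Q l < u_star"
    hence le: "u_star \<le> u" by (simp add: u_def)
    \<comment> \<open>So \<open>u\<close> lies left of the vertex of the parabola; if
      \<open>u_star \<le> u\<close>, the polynomial would be nonnegative at
      \<open>u_star\<close>.\<close>
    have "2 * q * u < l" using q l s by (simp add: u)
    moreover have "2 * q * u_star \<le> 2 * q * u" using le q by simp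
    ultimately have "q * (u + u_star) - l \<le> 0" by (simp add: algebra_simps)
    hence "0 \<le> (u_star - u) * (q * (u + u_star) - l)" using le by (simp add: mult_nonpos_nonpos)
    also have "\<dots> = (q * u_star\<^sup>2 - l * u_star + 1) - (q * u\<^sup>2 - l * u + 1)"
      by (simp add: algebra_simps power2_eq_square)
    also have "\<dots> = u_star * (lambda_star Q - l)"
      using root u_star_bounds by (simp add: lambda_star_eq q_def field_simps power2_eq_square)
    finally show False using assms(2) u_star_bounds by (simp add: zero_le_mult_iff)
  qed
qed

text \<open>At \<open>lambda_star Q\<close> the roots are \<open>u_star\<close> and
  \<open>1 / (q * u_star)\<close>, and \<open>u_of\<close> selects the smaller one.\<close>

lemma u_of_lambda_star:
  assumes "3 \<le> Q" "Q \<le> 7"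
  shows "u_of Q (lambda_star Q) = u_star"
proof -
  define q where "q = real Q - 1"
  define l where "l = lambda_star Q"
  have q: "0 < q" "q \<le> 6" using assms by (auto simp: q_def)
  have l: "0 < l" "l = 1 / u_star + q * u_star"
    using assms lambda_star_pos[of Q] by (simp_all add: l_def q_def lambda_star_eq)
  \<comment> \<open>The bound \<open>Q \<le> 7\<close> enters here:
    \<open>6 * u_star \<le> 3 - u_star\<close> follows from \<open>u_star < 2 / 5\<close>, and it
    fixes the sign of the square root below.\<close>
  have "q * u_star \<le> 6 * u_star" using q u_star_bounds by simp
  also have "\<dots> \<le> 1 / u_star" unfolding inverse_u_star using u_star_bounds by simp
  finally have "0 \<le> (1 / u_star - q * u_star) / l" using l(1) by simp
  moreover have "1 - 4 * q * (1 / l)\<^sup>2 = ((1 / u_star - q * u_star) / l)\<^sup>2"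
  proof -
    have "l\<^sup>2 - 4 * q = (1 / u_star - q * u_star)\<^sup>2"
      using u_star_bounds by (simp add: l(2) power2_eq_square field_simps)
    moreover have "1 - 4 * q * (1 / l)\<^sup>2 = (l\<^sup>2 - 4 * q) / l\<^sup>2"
      using l(1) by (simp add: power_divide diff_divide_distrib)
    ultimately show ?thesis by (simp only: power_divide)
  qed
  ultimately have "sqrt (1 - 4 * q * (1 / l)\<^sup>2) = (1 / u_star - q * u_star) / l"
    by (metis real_sqrt_unique)
  hence "u_of Q l = (1 - (1 / u_star - q * u_star) / l) / (2 * q * (1 / l))"
    by (simp add: u_of_def flip: q_def)
  also have "(1 - d / l) / (2 * q * (1 / l)) = (l - d) / (2 * q)" for d
    using l(1) q by (simp add: field_simps)
  also have "(l - (1 / u_star - q * u_star)) / (2 * q) = u_star" using q by (simp add: l(2))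
  finally show ?thesis by (simp add: l_def)
qed

text \<open>The Green function at a vertex of the looped path equals \<open>1 / gap Q l\<close>.\<close>

definition gap :: "nat \<Rightarrow> real \<Rightarrow> real" where
  "gap Q l = sqrt ((1 / u_of Q l + u_of Q l - 1)\<^sup>2 - 4)"

text \<open>\<open>u\<^sup>2 - 3 * u + 1\<close> has the roots \<open>u_star\<close> and
  \<open>3 - u_star\<close>, and \<open>u_of Q l\<close> lies below both.\<close>

lemma u_of_trace_gt_2:
  assumes "3 \<le> Q" "lambda_star Q < l"
  shows "2 < 1 / u_of Q l + u_of Q l - 1"
proof -
  define u where "u = u_of Q l"
  have u: "0 < u" "u < u_star" using u_of_bounds[OF assms] by (simp_all add: u_def)
  have "0 < (u_star - u) * (3 - u_star - u)"
    using u u_star_bounds by (intro mult_pos_pos) auto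
  also have "\<dots> = u\<^sup>2 - 3 * u + (3 * u_star - u_star\<^sup>2)"
    by (simp add: algebra_simps power2_eq_square)
  finally have "0 < u\<^sup>2 - 3 * u + 1" by (simp add: u_star_root)
  thus ?thesis using u by (simp add: u_def[symmetric] field_simps power2_eq_square)
qed

lemma gap_pos: "3 \<le> Q \<Longrightarrow> lambda_star Q < l \<Longrightarrow> 0 < gap Q l"
  using u_of_trace_gt_2[of Q l] power_strict_mono[of 2 "1 / u_of Q l + u_of Q l - 1" 2]
  by (simp add: gap_def)

text \<open>With \<open>w\<close> the trace and \<open>e\<close> the gap, \<open>v\<close> is the
  smaller root \<open>(w - e) / 2\<close> of \<open>v\<^sup>2 - w * v + 1\<close>; the other root is
  \<open>1 / v\<close>.\<close>

lemma obtain_decay_rate: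
  assumes "3 \<le> Q" "lambda_star Q < l"
  obtains v where "0 < v" "v < 1" "v + 1 / v = 1 / u_of Q l + u_of Q l - 1" "1 / v - v = gap Q l"
proof -
  define w where "w = 1 / u_of Q l + u_of Q l - 1"
  define e where "e = gap Q l"
  have w: "2 < w" using u_of_trace_gt_2[OF assms] by (simp add: w_def)
  have e: "0 < e" using gap_pos[OF assms] by (simp add: e_def)
  have e2: "e\<^sup>2 = w\<^sup>2 - 4"
    using w power_strict_mono[of 2 w 2] by (simp add: e_def gap_def flip: w_def)
  have "(w - e) * (w + e) = 4" using e2 by (simp add: algebra_simps power2_eq_square)
  hence inv: "1 / ((w - e) / 2) = (w + e) / 2"
    using w e by (cases "w = e") (auto simp: field_simps)
  have "e\<^sup>2 < w\<^sup>2" using e2 by simp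
  hence "e < w" by (rule power2_less_imp_less) (use w in simp)
  moreover have "(w - e) / 2 < 1"
  proof -
    have "(w - 2)\<^sup>2 < e\<^sup>2" unfolding e2 using w by (simp add: power2_eq_square algebra_simps)
    hence "w - 2 < e" by (rule power2_less_imp_less) (use e in simp)
    thus ?thesis by simp
  qed
  moreover have "(w - e) / 2 + 1 / ((w - e) / 2) = w" "1 / ((w - e) / 2) - (w - e) / 2 = e"
    unfolding inv by (simp_all add: field_simps)
  ultimately show thesis
    using that[of "(w - e) / 2", folded w_def e_def] by simp
qed

lemma tendsto_gap:
  assumes "3 \<le> Q" "Q \<le> 7"
  shows "(gap Q \<longlongrightarrow> 0) (at_right (lambda_star Q))"
proof -
  let ?l = "lambda_star Q"
  have l: "?l \<noteq> 0" "real Q - 1 \<noteq> 0" using lambda_star_pos[of Q] assms by auto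
  have "(u_of Q \<longlongrightarrow> u_of Q ?l) (at_right ?l)"
    unfolding u_of_def by (intro tendsto_intros) (use l in auto)
  hence u: "(u_of Q \<longlongrightarrow> u_star) (at_right ?l)" by (simp add: u_of_lambda_star[OF assms])
  have "(gap Q \<longlongrightarrow> sqrt ((1 / u_star + u_star - 1)\<^sup>2 - 4)) (at_right ?l)"
    unfolding gap_def by (intro tendsto_intros u) (use u_star_bounds in auto)
  thus ?thesis by (simp add: inverse_u_star)
qed

text \<open>Up to normalisation, \<open>v ^ nat \<bar>n\<bar>\<close> is the Green function of the
  integer line at spectral parameter \<open>v + 1 / v\<close>.\<close>

lemma two_sided_geometric:
  fixes v :: real
  assumes "v \<noteq> 0"
  shows "(v + 1 / v) * v ^ nat \<bar>n\<bar> - (v ^ nat \<bar>n - 1\<bar> + v ^ nat \<bar>n + 1\<bar>)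
    = (if n = 0 then 1 / v - v else 0)"
proof -
  have pos: "(v + 1 / v) * v ^ nat \<bar>n\<bar> - (v ^ nat \<bar>n - 1\<bar> + v ^ nat \<bar>n + 1\<bar>) = 0" if "n > 0" for n
  proof -
    define k where "k = nat (n - 1)"
    hence k: "n = int k + 1" using that by simp
    have "nat \<bar>n\<bar> = Suc k" "nat \<bar>n - 1\<bar> = k" "nat \<bar>n + 1\<bar> = Suc (Suc k)" using k by auto
    thus ?thesis using assms by (simp add: field_simps)
  qed
  show ?thesis
  proof (cases n "0::int" rule: linorder_cases)
    case less
    have abs: "\<bar>- n - 1\<bar> = \<bar>n + 1\<bar>" "\<bar>- n + 1\<bar> = \<bar>n - 1\<bar>" by auto
    from pos[of "- n"] less show ?thesis unfolding abs by (simp add: add.commute)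
  qed (use pos in \<open>auto simp: algebra_simps\<close>)
qed


section \<open>The homogeneous tree with a looped path\<close>

locale looped_tree =
  fixes T :: "'v graph" and Z :: "'v set" and Q :: nat and \<gamma> :: "int \<Rightarrow> 'v"
  assumes Q: "3 \<le> Q" "Q \<le> 7"
    and homogeneous: "homogeneous_tree Q T"
    and \<gamma>: "bij_betw \<gamma> UNIV Z"
    and adjacent_\<gamma>: "adjacent T (\<gamma> m) (\<gamma> n) \<longleftrightarrow> \<bar>m - n\<bar> = 1"
begin

abbreviation "G \<equiv> add_loops T Z"
abbreviation "lstar \<equiv> lambda_star Q"
abbreviation "A \<equiv> adjacency_op G"
abbreviation "A\<^sub>0 \<equiv> adjacency_op T"

lemma tree: "tree T"
  using homogeneous by (simp add: homogeneous_tree_def)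

lemma graph: "graph T"
  using tree by (simp add: tree_def connected_graph_def)

lemma card_nbrs_T: "card (nbrs T x) = Q"
  using homogeneous card_nbrs[OF graph] by (simp add: homogeneous_tree_def)

lemma finite_nbrs_T: "finite (nbrs T x)"
  by (rule card_ge_0_finite) (use card_nbrs_T Q in simp)

lemma not_self_nbr: "x \<notin> nbrs T x"
  using tree by (simp add: tree_def loopless_def nbrs_def adjacent_def)

lemma nbrs_G: "nbrs G x = (if x \<in> Z then insert x (nbrs T x) else nbrs T x)"
  by (auto simp: nbrs_def adjacent_def add_loops_def doubleton_eq_iff)

lemma sum_nbrs_G:
  "(\<Sum>y\<in>nbrs G x. f y) = (\<Sum>y\<in>nbrs T x. f y) + (if x \<in> Z then f x else (0 :: 'b::comm_monoid_add))"
  using finite_nbrs_T not_self_nbr by (simp add: nbrs_G add.commute)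

lemma Z_eq: "Z = range \<gamma>"
  using \<gamma> by (simp add: bij_betw_def)

lemma inj_\<gamma>: "inj \<gamma>"
  using \<gamma> by (simp add: bij_betw_def)

lemma nbrs_\<gamma>: "nbrs T (\<gamma> n) \<inter> Z = {\<gamma> (n - 1), \<gamma> (n + 1)}"
proof -
  have "\<bar>n - m\<bar> = 1 \<longleftrightarrow> m = n - 1 \<or> m = n + 1" for m by auto
  thus ?thesis by (auto simp: Z_eq nbrs_def adjacent_\<gamma>)
qed

lemma path_connected:
  assumes "s \<in> Z" "t \<in> Z"
  shows "(\<lambda>y z. adjacent T y z \<and> y \<in> Z \<and> z \<in> Z)\<^sup>*\<^sup>* s t" (is "?r\<^sup>*\<^sup>* s t")
proof -
  have up: "?r\<^sup>*\<^sup>* (\<gamma> m) (\<gamma> (m + int k))" for m k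
  proof (induction k)
    case (Suc k)
    have "?r (\<gamma> (m + int k)) (\<gamma> (m + int (Suc k)))" by (auto simp: adjacent_\<gamma> Z_eq)
    with Suc show ?case by (rule rtranclp.rtrancl_into_rtrancl)
  qed simp
  have "symp ?r" by (auto intro: sympI adjacent_sym)
  hence "symp ?r\<^sup>*\<^sup>*" by (rule symp_rtranclp)
  obtain m n where mn: "s = \<gamma> m" "t = \<gamma> n" using assms by (auto simp: Z_eq)
  show ?thesis
  proof (cases "m \<le> n")
    case True
    thus ?thesis using up[of m "nat (n - m)"] by (simp add: mn)
  next
    case False
    hence "?r\<^sup>*\<^sup>* t s" using up[of n "nat (m - n)"] by (simp add: mn)
    thus ?thesis by (rule sympD[OF \<open>symp ?r\<^sup>*\<^sup>*\<close>])
  qed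
qed

sublocale Z: subtree T Z
  using tree finite_nbrs_T path_connected by unfold_locales (auto simp: Z_eq)

sublocale V: subtree T "{y}" for y
  using tree finite_nbrs_T by unfold_locales auto

definition \<phi> :: "'v \<Rightarrow> real" where
  "\<phi> x = u_star ^ Z.depth x"

lemma sum_\<phi>: "(\<Sum>y\<in>nbrs G x. \<phi> y) = lstar * \<phi> x"
proof (cases "x \<in> Z")
  case True
  then obtain n where n: "x = \<gamma> n" by (auto simp: Z_eq)
  have "card (nbrs T x \<inter> Z) = 2" using inj_\<gamma> by (simp add: n nbrs_\<gamma> inj_eq)
  moreover have "\<phi> x = 1" using True Z.depth_eq_0_iff[of x] by (simp add: \<phi>_def)
  \<comment> \<open>The 3 counts two path neighbours and the loop; the remaining
    \<open>Q - 2\<close> neighbours start branches.\<close>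
  ultimately have "(\<Sum>y\<in>nbrs G x. \<phi> y) = 3 + (real Q - 2) * u_star"
    using Z.sum_nbrs_inside[OF True, of "\<lambda>_. 1" u_star] True
    by (simp add: sum_nbrs_G card_nbrs_T flip: \<phi>_def)
  also have "\<dots> = lstar" by (simp add: lambda_star_eq inverse_u_star algebra_simps)
  finally show ?thesis by (simp add: \<open>\<phi> x = 1\<close>)
next
  case False
  thus ?thesis
    using Z.sum_nbrs_outside[OF False, of u_star "\<lambda>_. 1"] u_star_bounds
    by (simp add: sum_nbrs_G card_nbrs_T lambda_star_eq flip: \<phi>_def)
qed

lemma \<phi>_pos: "0 < \<phi> x"
  using u_star_bounds by (simp add: \<phi>_def)

sublocale G: positive_supersolution G \<phi> lstar
proof
  show "(\<Sum>y\<in>nbrs G x. \<phi> y) \<le> lstar * \<phi> x" for x by (rule eq_refl[OF sum_\<phi>])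
qed (auto simp: \<phi>_pos nbrs_G finite_nbrs_T)

sublocale T: positive_supersolution T \<phi> lstar
proof
  \<comment> \<open>Dropping the loops only decreases the sum, so \<phi> remains a
    supersolution.\<close>
  show "(\<Sum>y\<in>nbrs T x. \<phi> y) \<le> lstar * \<phi> x" for x
    using \<phi>_pos[of x] by (simp flip: sum_\<phi> add: sum_nbrs_G less_imp_le)
qed (auto simp: \<phi>_pos finite_nbrs_T)

lemma adjacency_op_G: "A f = A\<^sub>0 f + restrict_ell2 Z f"
  by (rule ell2_eqI) (simp add: G.coord_adjacency_op T.coord_adjacency_op restrict_ell2.rep_eq sum_nbrs_G)

section \<open>Green functions of the tree and the looped tree\<close>

lemma depth_le_graph_dist: "y \<in> Z \<Longrightarrow> Z.depth z \<le> V.depth y z"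
  using V.depth_path[of y z] by (auto intro: Z.depth_le)

lemma graph_dist_eq: "graph_dist T y z = V.depth y z"
  by (simp add: graph_dist_def V.depth_def)

lemma resolvent_T_delta:
  assumes l: "lstar < l" and y: "y \<in> Z"
  shows "coord (resolvent A\<^sub>0 l (delta y)) z
    = of_real (u_of Q l ^ graph_dist T y z / (l - real Q * u_of Q l))"
proof -
  define u where "u = u_of Q l"
  note u = u_of_bounds[OF Q(1) l, folded u_def]
  define c where "c = l - real Q * u"
  \<comment> \<open>Positivity of \<open>c\<close> makes it a legitimate normalisation of the radial
    function \<open>u ^ V.depth y z\<close>.\<close>
  have "c = 1 / u - u" unfolding c_def by (subst u(3)[symmetric]) (simp add: algebra_simps)
  moreover have "u < 1" using u u_star_bounds by simp
  hence "u * u < 1 * 1" using u(1) by (intro mult_strict_mono) auto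
  hence "u < 1 / u" using u(1) by (simp add: field_simps)
  ultimately have c: "0 < c" by simp
  show ?thesis
    unfolding graph_dist_eq u_def[symmetric] c_def[symmetric]
  proof (rule T.resolvent_delta_eqI[OF l])
    fix z
    have sum: "(\<Sum>x\<in>nbrs T z. u ^ V.depth y x / c) = (\<Sum>x\<in>nbrs T z. u ^ V.depth y x) / c"
      by (simp add: sum_divide_distrib)
    show "l * (u ^ V.depth y z / c) - (\<Sum>x\<in>nbrs T z. u ^ V.depth y x / c) = (if z = y then 1 else 0)"
    proof (cases "z = y")
      case True
      have "V.depth y y = 0" using V.depth_eq_0_iff[of y y] by simp
      moreover have "(\<Sum>x\<in>nbrs T y. u ^ V.depth y x) = real Q * u"
        using V.sum_nbrs_inside[of y y "\<lambda>_. 1" u] not_self_nbr[of y] by (simp add: card_nbrs_T)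
      ultimately show ?thesis
        unfolding sum using True c by (simp add: c_def flip: diff_divide_distrib)
    next
      case False
      have "(\<Sum>x\<in>nbrs T z. u ^ V.depth y x) = l * u ^ V.depth y z"
        using V.sum_nbrs_outside[of z y u "\<lambda>_. 1"] False u(1) by (simp add: card_nbrs_T u(3))
      thus ?thesis unfolding sum using False by simp
    qed
    have "u ^ V.depth y z \<le> u_star ^ V.depth y z" using u by (intro power_mono) auto
    also have "\<dots> \<le> \<phi> z"
      unfolding \<phi>_def using u_star_bounds by (intro power_decreasing depth_le_graph_dist y) auto
    finally show "\<bar>u ^ V.depth y z / c\<bar> \<le> 1 / c * \<phi> z"
      using c u(1) by (simp add: divide_right_mono)
  qed
qed

text \<open>Selfadjointness turns coordinate \<open>x\<close> of the resolvent into a sum of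
  \<open>g\<close> against the Green function at \<open>x\<close>. This also shows that
  \<open>Abs_ell2\<close> in \<open>W_op\<close> receives a square-summable function.\<close>

lemma W_op_eq:
  assumes l: "lstar < l" and g: "g \<in> ell2_on Z"
  shows "(1 / l) *\<^sub>R W_op Q T Z (1 / l) g = restrict_ell2 Z (resolvent A\<^sub>0 l g)"
proof -
  interpret R: resolvent_point A\<^sub>0 l by (rule T.resolvent_point[OF l])
  have l0: "l \<noteq> 0" using R.l_pos by simp
  define k where "k x y = u_of Q l ^ graph_dist T x y / (l - real Q * u_of Q l)" for x y
  have "(\<Sum>\<^sub>\<infinity>y\<in>Z. of_real (W_entry Q (1 / l) (graph_dist T x y)) * coord g y)
      = of_real l * coord (resolvent A\<^sub>0 l g) x" if x: "x \<in> Z" for x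
  proof -
    have "coord (resolvent A\<^sub>0 l g) x = cinner g (resolvent A\<^sub>0 l (delta x))"
      by (simp flip: cinner_delta_right add: R.cinner_resolvent[OF T.selfadjoint_adjacency_op])
    also have "\<dots> = (\<Sum>\<^sub>\<infinity>y\<in>Z. of_real (k x y) * coord g y)"
      unfolding cinner_def
      by (rule infsum_cong_neutral)
         (use g in \<open>auto simp: ell2_on_def resolvent_T_delta[OF l x] k_def mult.commute\<close>)
    finally show ?thesis
      by (simp only: W_entry_eq[OF Q(1) l0] of_real_mult mult.assoc infsum_cmult_right' flip: k_def)
  qed
  hence "W_op Q T Z (1 / l) g
      = Abs_ell2 (\<lambda>x. if x \<in> Z then of_real l * coord (resolvent A\<^sub>0 l g) x else 0)"
    unfolding W_op_def matrix_op_def by (intro arg_cong[of _ _ Abs_ell2]) auto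
  also have "(\<lambda>x. if x \<in> Z then of_real l * coord (resolvent A\<^sub>0 l g) x else 0)
      = coord (l *\<^sub>R restrict_ell2 Z (resolvent A\<^sub>0 l g))"
    by (auto simp: restrict_ell2.rep_eq)
  finally have "W_op Q T Z (1 / l) g = l *\<^sub>R restrict_ell2 Z (resolvent A\<^sub>0 l g)"
    by (simp only: coord_inverse)
  thus ?thesis using l0 by simp
qed

text \<open>\<open>inv \<gamma>\<close> reads off the integer position of a vertex of
  \<open>Z\<close>; elsewhere its value is unspecified, and \<open>decay\<close> is evaluated at
  projections.\<close>

definition decay :: "real \<Rightarrow> 'v \<Rightarrow> real" where
  "decay v x = v ^ nat \<bar>inv \<gamma> x\<bar>"

lemma resolvent_G_delta:
  assumes l: "lstar < l"
  shows "coord (resolvent A l (delta (\<gamma> 0))) (\<gamma> 0) = of_real (1 / gap Q l)"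
proof -
  define u where "u = u_of Q l"
  note u = u_of_bounds[OF Q(1) l, folded u_def]
  obtain v where v: "0 < v" "v < 1" "v + 1 / v = 1 / u + u - 1" "1 / v - v = gap Q l"
    using obtain_decay_rate[OF Q(1) l, folded u_def] by blast
  define c where "c = gap Q l"
  have c: "0 < c" using gap_pos[OF Q(1) l] by (simp add: c_def)
  define h where "h x = decay v (Z.proj x) * u ^ Z.depth x" for x
  have decay_\<gamma>: "decay v (\<gamma> n) = v ^ nat \<bar>n\<bar>" for n
    using inj_\<gamma> by (simp add: decay_def)
  have h_\<gamma>: "h (\<gamma> n) = v ^ nat \<bar>n\<bar>" for n
  proof -
    have "\<gamma> n \<in> Z" by (simp add: Z_eq)
    hence "Z.depth (\<gamma> n) = 0" "Z.proj (\<gamma> n) = \<gamma> n"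
      using Z.depth_eq_0_iff[of "\<gamma> n"] Z.proj_in by auto
    thus ?thesis by (simp add: h_def decay_\<gamma>)
  qed
  have h: "l * h x - (\<Sum>y\<in>nbrs G x. h y) = (if x = \<gamma> 0 then c else 0)" for x
  proof (cases "x \<in> Z")
    case True
    then obtain n where n: "x = \<gamma> n" by (auto simp: Z_eq)
    have card: "card (nbrs T x \<inter> Z) = 2" using inj_\<gamma> by (simp add: n nbrs_\<gamma> inj_eq)
    have "(\<Sum>y\<in>nbrs T x. h y)
        = (\<Sum>y\<in>nbrs T x \<inter> Z. decay v y) + (real Q - 2) * u * decay v x"
      unfolding h_def using Z.sum_nbrs_inside[OF True, of "decay v" u]
      by (simp add: card card_nbrs_T)
    also have "(\<Sum>y\<in>nbrs T x \<inter> Z. decay v y) = v ^ nat \<bar>n - 1\<bar> + v ^ nat \<bar>n + 1\<bar>"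
      using inj_\<gamma> by (simp add: n nbrs_\<gamma> inj_eq decay_\<gamma>)
    finally have "l * h x - (\<Sum>y\<in>nbrs G x. h y)
        = (l - 1 - (real Q - 2) * u) * v ^ nat \<bar>n\<bar> - (v ^ nat \<bar>n - 1\<bar> + v ^ nat \<bar>n + 1\<bar>)"
      using True by (simp add: sum_nbrs_G n h_\<gamma> decay_\<gamma> algebra_simps)
    \<comment> \<open>Removing the loop and the \<open>Q - 2\<close> branches from \<open>l\<close>
      leaves the trace \<open>1 / u + u - 1\<close>, so on \<open>Z\<close> the equation becomes
      that of the integer line.\<close>
    also have "l - 1 - (real Q - 2) * u = v + 1 / v"
      unfolding v(3) by (subst u(3)[symmetric]) (simp add: algebra_simps)
    also note two_sided_geometric[of v n]
    finally show ?thesis using v inj_\<gamma> by (simp add: n inj_eq c_def)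
  next
    case False
    hence "x \<noteq> \<gamma> 0" by (auto simp: Z_eq)
    thus ?thesis
      using Z.sum_nbrs_outside[OF False, of u "decay v"] u False
      by (simp add: sum_nbrs_G card_nbrs_T flip: h_def)
  qed
  have "coord (resolvent A l (delta (\<gamma> 0))) (\<gamma> 0) = of_real (h (\<gamma> 0) / c)"
  proof (rule G.resolvent_delta_eqI[OF l])
    fix x
    show "l * (h x / c) - (\<Sum>y\<in>nbrs G x. h y / c) = (if x = \<gamma> 0 then 1 else 0)"
      using h[of x] c by (simp flip: sum_divide_distrib diff_divide_distrib split: if_splits)
    have "0 \<le> decay v (Z.proj x)" "decay v (Z.proj x) \<le> 1"
      using v by (simp_all add: decay_def power_le_one)
    moreover have "u ^ Z.depth x \<le> \<phi> x" "0 \<le> u ^ Z.depth x"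
      unfolding \<phi>_def using u by (auto intro: power_mono)
    ultimately have "\<bar>h x\<bar> \<le> 1 * \<phi> x"
      unfolding h_def abs_mult by (intro mult_mono) auto
    thus "\<bar>h x / c\<bar> \<le> 1 / c * \<phi> x" using c by (simp add: divide_right_mono)
  qed
  thus ?thesis using h_\<gamma>[of 0] by (simp add: c_def)
qed

section \<open>Blow-up at \<open>lstar\<close>: the norm and recurrence\<close>

lemma inverse_gap_at_top: "filterlim (\<lambda>l. 1 / gap Q l) at_top (at_right lstar)"
proof -
  have "\<forall>\<^sub>F l in at_right lstar. 0 < gap Q l"
    using gap_pos[OF Q(1)] by (auto simp: eventually_at_filter)
  thus ?thesis
    using filterlim_inverse_at_top[OF tendsto_gap[OF Q]] by (simp add: inverse_eq_divide)
qed

text \<open>A norm below \<open>lstar\<close> would bound the Green function as \<open>l \<down> lstar\<close>.\<close>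

lemma onorm_eq: "onorm A = lstar"
proof (rule ccontr)
  assume "onorm A \<noteq> lstar"
  hence less: "onorm A < lstar" using G.onorm_adjacency_op_le by simp
  define C where "C = 1 / (lstar - onorm A)"
  have "1 / gap Q l \<le> C" if l: "lstar < l" for l
  proof -
    interpret R: resolvent_point A l by (rule G.resolvent_point[OF l])
    have "1 / gap Q l = cmod (coord (resolvent A l (delta (\<gamma> 0))) (\<gamma> 0))"
      using gap_pos[OF Q(1) l] by (simp add: resolvent_G_delta[OF l] norm_divide)
    also have "\<dots> \<le> norm (resolvent A l (delta (\<gamma> 0)))" by (rule norm_coord_le)
    also have "\<dots> \<le> 1 / (l - onorm A)" using R.norm_resolvent_le[of "delta (\<gamma> 0)"] by (simp add: norm_delta)
    also have "\<dots> \<le> C" unfolding C_def using l less by (intro divide_left_mono mult_pos_pos) auto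
    finally show ?thesis .
  qed
  hence "\<forall>\<^sub>F l in at_right lstar. 1 / gap Q l \<le> C" by (auto simp: eventually_at_filter)
  moreover have "\<forall>\<^sub>F l in at_right lstar. C < 1 / gap Q l"
    using inverse_gap_at_top by (simp add: filterlim_at_top_dense)
  ultimately have "\<forall>\<^sub>F l in at_right lstar. False" by eventually_elim simp
  thus False by (simp add: trivial_limit_at_right_real)
qed

lemma recurrent: "recurrent G"
proof -
  have "graph G"
    using graph by (fastforce simp: graph_def add_loops_def)
  moreover have "(adjacent G)\<^sup>*\<^sup>* x y" for x y
  proof -
    have "(adjacent T)\<^sup>*\<^sup>* x y" using tree by (simp add: tree_def connected_graph_def)
    thus ?thesis
      by (rule rtranclp_mono[THEN predicate2D, rotated]) (auto simp: adjacent_def add_loops_def)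
  qed
  moreover have "filterlim (\<lambda>l. Re (cinner (resolvent A l (delta (\<gamma> 0))) (delta (\<gamma> 0)))) at_top
      (at_right (onorm A))"
  proof -
    have "\<forall>\<^sub>F l in at_right lstar.
        1 / gap Q l = Re (cinner (resolvent A l (delta (\<gamma> 0))) (delta (\<gamma> 0)))"
      unfolding cinner_delta_right eventually_at_filter
      by (intro always_eventually allI impI) (simp add: resolvent_G_delta)
    thus ?thesis
      unfolding onorm_eq by (rule filterlim_cong[THEN iffD1, OF refl refl _ inverse_gap_at_top])
  qed
  ultimately show ?thesis
    unfolding recurrent_def connected_graph_def
    using G.bounded_linear_adjacency_op G.selfadjoint_adjacency_op by blast
qed

end

theorem theorem4p1:
  fixes T :: "'v graph" and Z :: "'v set" and Q :: nat
  assumes "3 \<le> Q" and "Q \<le> 7"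
    and "homogeneous_tree Q T"
    and "biinfinite_path T Z"
  shows
    "let A\<^sub>0 = adjacency_op T;
         A = adjacency_op (add_loops T Z);
         P = orthogonal_proj (ell2_on Z);
         D = (\<lambda>l g. g - (1 / l) *\<^sub>R W_op Q T Z (1 / l) g)
     in lambda_star Q = onorm A \<and>
        (\<forall>l > lambda_star Q.
           boundedly_invertible_on UNIV (\<lambda>f. l *\<^sub>R f - A f) \<and>
           boundedly_invertible_on UNIV (\<lambda>f. l *\<^sub>R f - A\<^sub>0 f) \<and>
           boundedly_invertible_on (ell2_on Z) (D l) \<and>
           (\<forall>f. resolvent A l f =
              resolvent A\<^sub>0 l (f + P (inv_into (ell2_on Z) (D l) (P (resolvent A\<^sub>0 l f)))))) \<and>
        recurrent (add_loops T Z)"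
proof -
  obtain \<gamma> :: "int \<Rightarrow> 'v" where \<gamma>: "bij_betw \<gamma> UNIV Z"
    "\<And>m n. adjacent T (\<gamma> m) (\<gamma> n) \<longleftrightarrow> \<bar>m - n\<bar> = 1"
    using assms(4) unfolding biinfinite_path_def by blast
  interpret looped_tree T Z Q \<gamma> by (rule looped_tree.intro) (use assms \<gamma> in auto)
  show ?thesis
    unfolding Let_def orthogonal_proj_ell2_on
  proof (intro conjI allI impI)
    fix l assume l: "lstar < l"
    note points = G.resolvent_point[OF l] T.resolvent_point[OF l]
    show "boundedly_invertible_on UNIV (\<lambda>f. l *\<^sub>R f - A f)"
      "boundedly_invertible_on UNIV (\<lambda>f. l *\<^sub>R f - A\<^sub>0 f)"
      using points[THEN resolvent_point.boundedly_invertible] by auto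
    \<comment> \<open>By \<open>W_op_eq\<close> this operator agrees on \<open>ell2_on Z\<close>
      with \<open>1 - P R\<^sub>0 P\<close>, as the perturbation lemma demands.\<close>
    note perturbation = resolvent_perturbation_by_projection[where S = Z, OF points adjacency_op_G,
        where D = "\<lambda>g. g - (1 / l) *\<^sub>R W_op Q T Z (1 / l) g"]
    show "boundedly_invertible_on (ell2_on Z) (\<lambda>g. g - (1 / l) *\<^sub>R W_op Q T Z (1 / l) g)"
      by (rule perturbation(1)) (simp only: W_op_eq[OF l])
    show "resolvent A l f = resolvent A\<^sub>0 l (f + restrict_ell2 Z (inv_into (ell2_on Z)
        (\<lambda>g. g - (1 / l) *\<^sub>R W_op Q T Z (1 / l) g) (restrict_ell2 Z (resolvent A\<^sub>0 l f))))" for f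
      by (rule perturbation(2)) (simp only: W_op_eq[OF l])
  qed (use onorm_eq recurrent in auto)
qed

end
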